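(* Assume the Uniformity Conjecture and the special case of the Lander--Parkin--Selfridge conjecture, both stated in the context. Then there is an absolute constant $C$ such that $M_k(n)\le C$ for all integers $k\ge2$ and $n\ne0$.
   Context: Uniformity Conjecture (Caporaso--Harris--Mazur): for each integer $g\ge2$ there is a constant $C_g$ such that every (smooth, projective, geometrically irreducible) curve of genus $g$ defined over $\mathbb{Q}$ has at most $C_g$ rational points over $\mathbb{Q}$. Conjecture (Lander--Parkin--Selfridge, special case): if $k\ge25$ is an integer, then there do not exist distinct positive integers $a_1,b_1,\ldots,a_{12},b_{12}$ such that $\sum_{i=1}^{12}a_i^k=\sum_{i=1}^{12}b_i^k$. $\mathbb{N}$ denotes the set of positive integers, and a (perfect) $k$-th power means an integer $x^k$ with $x\in\mathbb{N}$. For an integer $k\ge2$ and a nonzero integer $n$, a set $A\subseteq\mathbb{N}$ has property $D_k(n)$ if $ab+n$ is a $k$-th power for all $a,b\in A$ with $a\ne b$, and $M_k(n)=\sup\{|A|:A\subseteq\mathbb{N}\text{ has property }D_k(n)\}$. *)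

theory Defs
  imports
    Complex_Main
    "HOL-Library.Function_Algebras"
    "HOL-Library.Poly_Mapping"
    "HOL-Library.Extended_Nat"
    "HOL-Computational_Algebra.Polynomial"
begin

section \<open>Multivariate polynomials\<close>

text \<open>A polynomial in the variables \<open>x\<^sub>0, x\<^sub>1, \<dots>\<close> is a finitely supported map from exponent
  vectors to coefficients. Its restriction to \<open>x\<^sub>0, \<dots>, x\<^sub>N\<close> is made explicit by
  the sets \<open>mpolys N\<close> and \<open>forms N d\<close>.\<close>

type_synonym monom_exp = "nat \<Rightarrow>\<^sub>0 nat"
type_synonym 'a mpoly = "monom_exp \<Rightarrow>\<^sub>0 'a"

definition mpolys :: "nat \<Rightarrow> 'a::zero mpoly set" where
  "mpolys N = {p. \<forall>m \<in> Poly_Mapping.keys p. Poly_Mapping.keys m \<subseteq> {..N}}"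

text \<open>Homogeneous polynomials of degree \<open>d\<close> in \<open>x\<^sub>0, \<dots>, x\<^sub>N\<close> (including \<open>0\<close>).\<close>

definition forms :: "nat \<Rightarrow> nat \<Rightarrow> 'a::zero mpoly set" where
  "forms N d = {p \<in> mpolys N. \<forall>m \<in> Poly_Mapping.keys p. (\<Sum>i\<le>N. Poly_Mapping.lookup m i) = d}"

definition mpoly_eval :: "(nat \<Rightarrow> 'a) \<Rightarrow> 'a::comm_semiring_1 mpoly \<Rightarrow> 'a" where
  "mpoly_eval x p = (\<Sum>m \<in> Poly_Mapping.keys p.
     Poly_Mapping.lookup p m * (\<Prod>i \<in> Poly_Mapping.keys m. x i ^ Poly_Mapping.lookup m i))"

definition mpoly_pderiv :: "nat \<Rightarrow> 'a::comm_semiring_1 mpoly \<Rightarrow> 'a mpoly" where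
  "mpoly_pderiv i p = (\<Sum>m \<in> Poly_Mapping.keys p.
     Poly_Mapping.single (m - Poly_Mapping.single i 1)
       (of_nat (Poly_Mapping.lookup m i) * Poly_Mapping.lookup p m))"

definition mpoly_scale :: "'a::comm_semiring_1 \<Rightarrow> 'a mpoly \<Rightarrow> 'a mpoly" where
  "mpoly_scale c p = Poly_Mapping.single 0 c * p"

definition mpoly_to_complex :: "rat mpoly \<Rightarrow> complex mpoly" where
  "mpoly_to_complex = Poly_Mapping.map of_rat"

lemma vector_space_mpoly_scale: "vector_space (mpoly_scale :: 'a::field \<Rightarrow> _)"
  by unfold_locales
    (auto simp: mpoly_scale_def algebra_simps single_add mult_single simp flip: mult.assoc)

text \<open>The ideal of \<open>K[x\<^sub>0, \<dots>, x\<^sub>N]\<close> generated by a finite set \<open>F\<close>.\<close>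

definition ideal_of :: "nat \<Rightarrow> 'a::comm_semiring_1 mpoly set \<Rightarrow> 'a mpoly set" where
  "ideal_of N F = {(\<Sum>f\<in>F. q f * f) | q. \<forall>f\<in>F. q f \<in> mpolys N}"


section \<open>Projective space\<close>

text \<open>Homogeneous coordinates are sequences vanishing beyond index \<open>N\<close>; a point of
  projective \<open>N\<close>-space is a class of nonzero ones up to scaling.\<close>

definition hom_coords :: "nat \<Rightarrow> (nat \<Rightarrow> 'a::zero) set" where
  "hom_coords N = {x. (\<forall>i>N. x i = 0) \<and> (\<exists>i\<le>N. x i \<noteq> 0)}"

definition proportional :: "nat \<Rightarrow> ((nat \<Rightarrow> 'a::field) \<times> (nat \<Rightarrow> 'a)) set" where
  "proportional N = {(x, y) \<in> hom_coords N \<times> hom_coords N. \<exists>c. c \<noteq> 0 \<and> y = (\<lambda>i. c * x i)}"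

lemma equiv_proportional: "equiv (hom_coords N) (proportional N :: ((nat \<Rightarrow> 'a::field) \<times> _) set)"
proof (rule equivI)
  show "(proportional N :: ((nat \<Rightarrow> 'a) \<times> _) set) \<subseteq> hom_coords N \<times> hom_coords N"
    by (auto simp: proportional_def)
  show "refl_on (hom_coords N) (proportional N :: ((nat \<Rightarrow> 'a) \<times> _) set)"
    by (auto simp: refl_on_def proportional_def intro!: exI[of _ 1])
  show "sym (proportional N :: ((nat \<Rightarrow> 'a) \<times> _) set)"
  proof (rule symI)
    fix x y :: "nat \<Rightarrow> 'a" assume "(x, y) \<in> proportional N"
    then obtain c where "x \<in> hom_coords N" "y \<in> hom_coords N" "c \<noteq> 0" "y = (\<lambda>i. c * x i)"
      by (auto simp: proportional_def)
    then show "(y, x) \<in> proportional N"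
      by (auto simp: proportional_def field_simps intro!: exI[of _ "inverse c"])
  qed
  show "trans (proportional N :: ((nat \<Rightarrow> 'a) \<times> _) set)"
  proof (rule transI)
    fix x y z :: "nat \<Rightarrow> 'a"
    assume "(x, y) \<in> proportional N" "(y, z) \<in> proportional N"
    then obtain c d where "x \<in> hom_coords N" "z \<in> hom_coords N" "c \<noteq> 0" "d \<noteq> 0"
        "z = (\<lambda>i. d * (c * x i))"
      by (auto simp: proportional_def)
    then show "(x, z) \<in> proportional N"
      by (auto simp: proportional_def intro!: exI[of _ "d * c"])
  qed
qed

definition proj_space :: "nat \<Rightarrow> (nat \<Rightarrow> 'a::field) set set" where
  "proj_space N = hom_coords N // proportional N"

definition proj_zeros :: "nat \<Rightarrow> 'a::field mpoly set \<Rightarrow> (nat \<Rightarrow> 'a) set set" where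
  "proj_zeros N F = {P \<in> proj_space N. \<forall>x\<in>P. \<forall>f\<in>F. mpoly_eval x f = 0}"

definition zariski_closed :: "nat \<Rightarrow> (nat \<Rightarrow> 'a::field) set set \<Rightarrow> bool" where
  "zariski_closed N Z \<longleftrightarrow> (\<exists>G \<subseteq> (\<Union>d. forms N d). Z = proj_zeros N G)"

definition zariski_irreducible :: "nat \<Rightarrow> (nat \<Rightarrow> 'a::field) set set \<Rightarrow> bool" where
  "zariski_irreducible N X \<longleftrightarrow> X \<noteq> {} \<and>
     (\<forall>A B. zariski_closed N A \<longrightarrow> zariski_closed N B \<longrightarrow> X \<subseteq> A \<union> B \<longrightarrow> X \<subseteq> A \<or> X \<subseteq> B)"


section \<open>Projective curves over the rationals\<close>

text \<open>A closed subscheme of projective \<open>N\<close>-space over the rationals is given by a finite set \<open>F\<close>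
  of homogeneous equations; write \<open>R = \<rat>[x\<^sub>0, \<dots>, x\<^sub>N]\<close> and \<open>I\<close> for the ideal generated by \<open>F\<close>.
  The Hilbert function at \<open>t\<close> is the dimension of the degree \<open>t\<close> part of \<open>R/I\<close>. The subtraction
  below does not truncate, since \<open>I\<^sub>t\<close> is a subspace of the finite-dimensional space \<open>R\<^sub>t\<close>.\<close>

definition hilbert_function :: "nat \<Rightarrow> rat mpoly set \<Rightarrow> nat \<Rightarrow> nat" where
  "hilbert_function N F t =
     vector_space.dim mpoly_scale (forms N t :: rat mpoly set)
     - vector_space.dim mpoly_scale (ideal_of N F \<inter> forms N t)"

definition is_hilbert_poly :: "nat \<Rightarrow> rat mpoly set \<Rightarrow> rat poly \<Rightarrow> bool" where
  "is_hilbert_poly N F P \<longleftrightarrow>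
     (\<forall>\<^sub>F t in sequentially. of_nat (hilbert_function N F t) = poly P (of_nat t))"

text \<open>The dimension is the degree of the Hilbert polynomial; the zero polynomial, whose degree
  is \<open>0\<close> in the library, only occurs for the empty scheme.\<close>

definition has_dimension :: "nat \<Rightarrow> rat mpoly set \<Rightarrow> nat \<Rightarrow> bool" where
  "has_dimension N F r \<longleftrightarrow> (\<exists>P. is_hilbert_poly N F P \<and> P \<noteq> 0 \<and> Polynomial.degree P = r)"

definition complex_points :: "nat \<Rightarrow> rat mpoly set \<Rightarrow> (nat \<Rightarrow> complex) set set" where
  "complex_points N F = proj_zeros N (mpoly_to_complex ` F)"

definition rational_points :: "nat \<Rightarrow> rat mpoly set \<Rightarrow> (nat \<Rightarrow> rat) set set" where
  "rational_points N F = proj_zeros N F"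

text \<open>Irreducibility after base change to one algebraically closed extension, here the complex
  numbers, is the same as after base change to the algebraic closure of the rationals.\<close>

definition geometrically_irreducible :: "nat \<Rightarrow> rat mpoly set \<Rightarrow> bool" where
  "geometrically_irreducible N F \<longleftrightarrow> zariski_irreducible N (complex_points N F)"

definition gradient_at :: "(nat \<Rightarrow> complex) \<Rightarrow> rat mpoly \<Rightarrow> (nat \<Rightarrow> complex)" where
  "gradient_at x f = (\<lambda>i. mpoly_eval x (mpoly_to_complex (mpoly_pderiv i f)))"

definition jacobian_rank :: "rat mpoly set \<Rightarrow> (nat \<Rightarrow> complex) \<Rightarrow> nat" where
  "jacobian_rank F x =
     vector_space.dim (\<lambda>(c::complex) v i. c * v i) (gradient_at x ` F)"

lemma vector_space_pointwise: "vector_space (\<lambda>(c::'a::field) v (i::nat). c * v i)"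
  by unfold_locales (auto simp: algebra_simps)

text \<open>Jacobian criterion in pure dimension \<open>r\<close>: the rank is \<open>N - r\<close> at every geometric point.
  As it refers to the given equations and not to the vanishing ideal of the point set, it implies
  that the scheme is reduced.\<close>

definition smooth_of_dimension :: "nat \<Rightarrow> rat mpoly set \<Rightarrow> nat \<Rightarrow> bool" where
  "smooth_of_dimension N F r \<longleftrightarrow>
     (\<forall>P \<in> complex_points N F. \<forall>x\<in>P. jacobian_rank F x + r = N)"

definition smooth_projective_curve :: "nat \<Rightarrow> rat mpoly set \<Rightarrow> bool" where
  "smooth_projective_curve N F \<longleftrightarrow>
     finite F \<and> F \<subseteq> (\<Union>d. forms N d) \<and>
     has_dimension N F 1 \<and>
     geometrically_irreducible N F \<and>
     smooth_of_dimension N F 1"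

text \<open>The arithmetic genus of a curve, \<open>1 - P(0)\<close> with \<open>P\<close> the Hilbert polynomial; for smooth
  projective geometrically irreducible curves it is the genus.\<close>

definition has_genus :: "nat \<Rightarrow> rat mpoly set \<Rightarrow> nat \<Rightarrow> bool" where
  "has_genus N F g \<longleftrightarrow> (\<exists>P. is_hilbert_poly N F P \<and> of_nat g = 1 - poly P 0)"


section \<open>The two conjectures\<close>

definition uniformity_conjecture :: bool where
  "uniformity_conjecture \<longleftrightarrow>
     (\<forall>g\<ge>2. \<exists>C::nat. \<forall>N F. smooth_projective_curve N F \<and> has_genus N F g \<longrightarrow>
        finite (rational_points N F) \<and> card (rational_points N F) \<le> C)"

definition lander_parkin_selfridge_special :: bool where
  "lander_parkin_selfridge_special \<longleftrightarrow>
     (\<forall>k\<ge>25. \<not> (\<exists>a b :: nat \<Rightarrow> nat.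
        (\<forall>i\<in>{1..12}. a i > 0 \<and> b i > 0) \<and>
        inj_on a {1..12} \<and> inj_on b {1..12} \<and> a ` {1..12} \<inter> b ` {1..12} = {} \<and>
        (\<Sum>i=1..12. a i ^ k) = (\<Sum>i=1..12. b i ^ k)))"


section \<open>Diophantine sets\<close>

definition is_kth_power :: "nat \<Rightarrow> int \<Rightarrow> bool" where
  "is_kth_power k m \<longleftrightarrow> (\<exists>x::nat. x > 0 \<and> m = int x ^ k)"

definition property_D :: "nat \<Rightarrow> int \<Rightarrow> nat set \<Rightarrow> bool" where
  "property_D k n A \<longleftrightarrow> (\<forall>a\<in>A. \<forall>b\<in>A. a \<noteq> b \<longrightarrow> is_kth_power k (int a * int b + n))"

definition ecard :: "'a set \<Rightarrow> enat" where
  "ecard A = (if finite A then enat (card A) else \<infinity>)"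

definition M :: "nat \<Rightarrow> int \<Rightarrow> enat" where
  "M k n = (SUP A \<in> {A. A \<subseteq> {1..} \<and> property_D k n A}. ecard A)"

end

theory Submission
  imports
    Defs
    "HOL-Computational_Algebra.Computational_Algebra"
    "HOL-Computational_Algebra.Field_as_Ring"
begin

text \<open>For \<open>k \<ge> 25\<close> put \<open>p\<^sub>i\<^sub>j = a\<^sub>i b\<^sub>j + n\<close>. The determinant of the \<open>3 \<times> 3\<close> matrix with rows
  \<open>(p\<^sub>1\<^sub>j)\<close>, \<open>(p\<^sub>2\<^sub>j)\<close>, \<open>(1, 1, 1)\<close> vanishes, so distinct \<open>a\<^sub>1, a\<^sub>2, b\<^sub>1, b\<^sub>2, b\<^sub>3\<close> in a set with property
  \<open>D\<^sub>k(n)\<close> give two equal sums of three \<open>k\<close>-th powers. All but six choices of \<open>b\<^sub>3\<close> make the six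
  powers distinct, and four rescaled copies of the relation contradict the conjecture of Lander,
  Parkin and Selfridge.

  For \<open>k < 25\<close> let \<open>a\<^sub>0 < \<dots> < a\<^sub>5\<close> be elements of the set. The binary quadratic forms
  \<open>q\<^sub>i = (a\<^sub>2\<^sub>i s + t) (a\<^sub>2\<^sub>i\<^sub>+\<^sub>1 s + t)\<close> are linearly independent and satisfy a quadratic relation \<open>Q\<close>,
  whose conic is smooth and transversal to the coordinate lines. Each further element \<open>b\<close> of the set
  gives a rational point on the smooth plane curve \<open>Q(u\<^sup>k, v\<^sup>k, w\<^sup>k) = 0\<close> of genus
  \<open>(2 k - 1) (k - 1)\<close>: evaluate at \<open>(s, t) = (b, n)\<close> and multiply the two \<open>k\<close>-th roots belonging to
  each \<open>q\<^sub>i\<close>. Different \<open>b\<close> give different points, so the uniformity conjecture bounds their number.\<close>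

section \<open>Large exponents\<close>

text \<open>The property passes to subsets, and an infinite set would have finite subsets of every
  size, so finite sets decide the supremum.\<close>

lemma M_le_if_card_le:
  assumes "\<And>T. finite T \<Longrightarrow> T \<subseteq> {1..} \<Longrightarrow> property_D k n T \<Longrightarrow> card T \<le> C"
  shows "M k n \<le> enat C"
  unfolding M_def
proof (rule SUP_least)
  fix A assume "A \<in> {A. A \<subseteq> {1..} \<and> property_D k n A}"
  then have A: "A \<subseteq> {1..}" "property_D k n A" by auto
  have sub: "card T \<le> C" if "finite T" "T \<subseteq> A" for T
    using assms[of T] that A unfolding property_D_def by blast
  then have "finite A"
    by (metis infinite_arbitrarily_large not_less_eq_eq)
  then show "ecard A \<le> enat C"
    using sub[of A] by (simp add: ecard_def)
qed

text \<open>If \<open>q < r\<close>, cancelling \<open>L ^ q\<close> makes \<open>u\<close> a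
  positive multiple of \<open>L\<close>, which is impossible for a digit.\<close>

lemma power_mult_digit_eq:
  fixes L u v :: nat
  assumes "0 < u" "u < L" "0 < v" "v < L" "L ^ q * u = L ^ r * v"
  shows "q = r \<and> u = v"
proof -
  have *: False if "0 < u" "u < L" "0 < v" "v < L" "L ^ q * u = L ^ r * v" "q < r" for q r u v
  proof -
    obtain d where d: "r = q + Suc d" using \<open>q < r\<close> less_iff_Suc_add by auto
    have "L ^ q * u = L ^ q * (L ^ Suc d * v)" using that by (simp add: d power_add)
    then have "u = L ^ Suc d * v" using that by simp
    moreover have "L ^ Suc d * v \<ge> L * 1"
      using that by (intro mult_mono) (auto simp: Suc_leI)
    ultimately show False using that by simp
  qed
  have "q = r" using *[of u v q r] *[of v u r q] assms by (metis linorder_neqE_nat)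
  then show ?thesis using assms by simp
qed

text \<open>Adding the given relation multiplied by \<open>1, L\<^sup>k, L\<^sup>2\<^sup>k, L\<^sup>3\<^sup>k\<close> with \<open>L\<close> large gives one with twelve
  distinct terms on each side.\<close>

lemma no_equal_sums_of_three_powers:
  fixes x y :: "nat \<Rightarrow> nat"
  assumes lps: "lander_parkin_selfridge_special" and "k \<ge> 25"
    and pos: "\<And>i. i < 3 \<Longrightarrow> x i > 0 \<and> y i > 0"
    and inj: "inj_on x {..<3}" "inj_on y {..<3}" "x ` {..<3} \<inter> y ` {..<3} = {}"
    and eq: "(\<Sum>i<3. x i ^ k) = (\<Sum>i<3. y i ^ k)"
  shows False
proof -
  define L where "L = Suc ((\<Sum>i<3. x i) + (\<Sum>i<3. y i))"
  have bd: "x i < L" "y i < L" if "i < 3" for i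
    using that member_le_sum[of i "{..<3}" x] member_le_sum[of i "{..<3}" y]
    by (auto simp: L_def less_Suc_eq_le intro: trans_le_add1 trans_le_add2)
  \<comment> \<open>Writing \<open>i - 1 = 3 q + j\<close>, the index \<open>i\<close> stands for
    the term \<open>z j\<close> in the copy scaled by \<open>L ^ q\<close>; four copies of three
    terms make twelve.\<close>
  define s where "s z i = L ^ ((i - 1) div 3) * (z ((i - 1) mod 3) :: nat)" for z i
  have m3: "(i - 1) mod 3 < 3" for i :: nat by simp
  have inj': "inj_on (s z) {1..12}"
    if "inj_on z {..<3}" "\<And>i. i < 3 \<Longrightarrow> z i > 0 \<and> z i < L" for z
  proof (rule inj_onI)
    fix i j :: nat assume ij: "i \<in> {1..12}" "j \<in> {1..12}" "s z i = s z j"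
    have "(i-1) div 3 = (j-1) div 3 \<and> z ((i-1) mod 3) = z ((j-1) mod 3)"
      using ij(3) that(2) m3 unfolding s_def by (intro power_mult_digit_eq) auto
    then have "(i-1) div 3 = (j-1) div 3" "(i-1) mod 3 = (j-1) mod 3"
      using that(1) m3 by (auto simp: inj_on_def)
    then have "i - 1 = j - 1" by (metis div_mult_mod_eq)
    then show "i = j" using ij by auto
  qed
  have disj: "s x ` {1..12} \<inter> s y ` {1..12} = {}"
  proof -
    have False if "s x i = s y j" for i j
    proof -
      have "(i-1) div 3 = (j-1) div 3 \<and> x ((i-1) mod 3) = y ((j-1) mod 3)"
        using that pos bd m3 unfolding s_def by (intro power_mult_digit_eq) auto
      then show False using inj(3) m3 by blast
    qed
    then show ?thesis by blast
  qed
  have sums: "(\<Sum>i=1..12. s z i ^ k) = (\<Sum>q<4. (L ^ q) ^ k) * (\<Sum>i<3. z i ^ k)" for z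
  proof -
    have expand: "(\<Sum>i=1..12. g i) =
        g 1 + g 2 + g 3 + g 4 + g 5 + g 6 + g 7 + g 8 + g 9 + g 10 + g 11 + g 12" for g :: "nat \<Rightarrow> nat"
      by (simp add: numeral_eq_Suc)
    have "(\<Sum>q<4. v q) * (\<Sum>i<3. w i) = v 0 * w 0 + v 0 * w 1 + v 0 * w 2 + v 1 * w 0 + v 1 * w 1 + v 1 * w 2
        + v 2 * w 0 + v 2 * w 1 + v 2 * w 2 + v 3 * w 0 + v 3 * w 1 + v 3 * w 2" for v w :: "nat \<Rightarrow> nat"
      by (simp add: numeral_eq_Suc algebra_simps)
    then show ?thesis
      unfolding expand by (simp only: s_def power_mult_distrib) simp
  qed
  have "L > 0" by (simp add: L_def)
  then have "\<forall>i\<in>{1..12}. s x i > 0 \<and> s y i > 0" using pos m3 by (auto simp: s_def)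
  moreover have "inj_on (s x) {1..12}" "inj_on (s y) {1..12}"
    using inj' inj pos bd by auto
  moreover have "(\<Sum>i=1..12. s x i ^ k) = (\<Sum>i=1..12. s y i ^ k)" using sums eq by simp
  ultimately show False
    using lps \<open>k \<ge> 25\<close> disj unfolding lander_parkin_selfridge_special_def by blast
qed

section \<open>Six distinct products from a vanishing determinant\<close>

lemma minor_eq:
  fixes a a' b b' n :: int
  shows "(a * b + n) * (a' * b' + n) - (a * b' + n) * (a' * b + n) = n * (a - a') * (b - b')"
  by (simp add: algebra_simps)

lemma card_linear_solutions_le_1:
  fixes p q :: int
  assumes "p \<noteq> 0 \<or> q \<noteq> 0"
  shows "card {z \<in> (S :: nat set). p * int z = q} \<le> 1"
proof -
  have "z = z'" if "p * int z = q" "p * int z' = q" for z z'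
    using that assms by auto
  then show ?thesis
    by (auto simp: card_le_Suc0_iff_eq[OF card_ge_0_finite] intro: ccontr)
       (metis (mono_tags, lifting) One_nat_def card.infinite card_le_Suc0_iff_eq le0 mem_Collect_eq)
qed

text \<open>If both vanished, \<open>n \<noteq> 0\<close> would make \<open>a1 b2 + n\<close> and
  \<open>a2 b1 + n\<close> equal, and then \<open>a1 = a2\<close>. Hence a coincidence equation
  whose linear coefficient may vanish is still not trivial.\<close>

lemma cross_coefficients_nonzero:
  fixes a1 a2 b1 b2 n :: int
  assumes "a1 \<noteq> a2" "n \<noteq> 0" "a1 > 0" "a2 > 0" "b1 > 0" "b2 > 0" "a1 * b2 + n > 0"
  shows "(a1 * b2 + n) * a2 - (a2 * b1 + n) * a1 \<noteq> 0 \<or> n * ((a2 * b1 + n) - (a1 * b2 + n)) \<noteq> 0"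
proof (rule ccontr)
  assume "\<not> ?thesis"
  then have 1: "(a1 * b2 + n) * a2 = (a2 * b1 + n) * a1" and "n * ((a2 * b1 + n) - (a1 * b2 + n)) = 0"
    by auto
  then have "a2 * b1 + n = a1 * b2 + n" using \<open>n \<noteq> 0\<close> by simp
  then show False using 1 assms by auto
qed

text \<open>Four elements serve as \<open>a1\<close>, \<open>a2\<close>, \<open>b1\<close>,
  \<open>b2\<close>; of the at least seven others at most six are excluded as
  \<open>b3\<close>.\<close>

lemma card_le_10_if_property_D:
  assumes lps: "lander_parkin_selfridge_special" and k: "k \<ge> 25" and n: "n \<noteq> 0"
    and T: "finite T" "T \<subseteq> {1..}" "property_D k n T"
  shows "card T \<le> 10"
proof (rule ccontr)
  assume "\<not> card T \<le> 10"
  then have cT: "card T \<ge> 11" by simp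
  then obtain B where B: "B \<subseteq> T" "card B = 4" "finite B"
    using obtain_subset_with_card_n[of 4 T] by auto
  then obtain a1 a2 b1 b2 where Beq: "B = {a1, a2, b1, b2}" and dB: "distinct [a1, a2, b1, b2]"
    by (auto simp: eval_nat_numeral card_Suc_eq)
  have ex: "\<exists>x>0. int a * int b + n = int x ^ k" if "a \<in> T" "b \<in> T" "a \<noteq> b" for a b
    using T(3) that unfolding property_D_def is_kth_power_def by blast
  then have posp: "int a * int b + n > 0" if "a \<in> T" "b \<in> T" "a \<noteq> b" for a b
    using that by (metis of_nat_0_less_iff zero_less_power)
  have pos: "int a > 0" if "a \<in> T" for a using that T(2) by auto
  define p where "p a b = int a * int b + n" for a b
  have inT: "a1 \<in> T" "a2 \<in> T" "b1 \<in> T" "b2 \<in> T" using B Beq by auto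
  have p4: "p a1 b1 > 0" "p a1 b2 > 0" "p a2 b1 > 0" "p a2 b2 > 0"
    using posp inT dB by (auto simp: p_def)
  have a4: "int a1 > 0" "int a2 > 0" "int b1 > 0" "int b2 > 0" using pos inT by auto
  define S where "S = T - B"
  have cS: "card S \<ge> 7" "finite S" using cT B T(1) by (auto simp: S_def card_Diff_subset)
  define E where "E = (\<lambda>(u, w). {z \<in> S. u * int z = w})"
  \<comment> \<open>A pair \<open>(u, w)\<close> stands for the equation \<open>u b3 = w\<close>.
    The first three say that two of the \<open>X i\<close> below coincide, the last three that two
    of the \<open>Y i\<close> do.\<close>
  define bad where "bad = [
     (p a1 b2 * int a2, p a1 b1 * p a2 b2 - p a1 b2 * n),
     (p a2 b1 * int a1, p a1 b1 * p a2 b2 - p a2 b1 * n),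
     (p a1 b2 * int a2 - p a2 b1 * int a1, n * (p a2 b1 - p a1 b2)),
     (p a1 b1 * int a2, p a1 b2 * p a2 b1 - p a1 b1 * n),
     (p a2 b2 * int a1, p a1 b2 * p a2 b1 - p a2 b2 * n),
     (p a1 b1 * int a2 - p a2 b2 * int a1, n * (p a2 b2 - p a1 b1))]"
  have nz: "fst uw \<noteq> 0 \<or> snd uw \<noteq> 0" if "uw \<in> set bad" for uw
  proof -
    have "p a1 b2 * int a2 - p a2 b1 * int a1 \<noteq> 0 \<or> n * (p a2 b1 - p a1 b2) \<noteq> 0"
      using cross_coefficients_nonzero[of "int a1" "int a2" n "int b1" "int b2"] dB a4 p4 n
      by (auto simp: p_def)
    moreover have "p a1 b1 * int a2 - p a2 b2 * int a1 \<noteq> 0 \<or> n * (p a2 b2 - p a1 b1) \<noteq> 0"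
      using cross_coefficients_nonzero[of "int a1" "int a2" n "int b2" "int b1"] dB a4 p4 n
      by (auto simp: p_def)
    ultimately show ?thesis using that a4 p4 unfolding bad_def by auto
  qed
  have "card (\<Union>uw\<in>set bad. E uw) \<le> (\<Sum>uw\<in>set bad. card (E uw))"
    by (rule card_UN_le) simp
  also have "\<dots> \<le> (\<Sum>uw\<in>set bad. 1)"
    using nz card_linear_solutions_le_1 by (intro sum_mono) (auto simp: E_def split: prod.splits)
  also have "\<dots> \<le> 6" using card_length[of bad] by (simp add: bad_def)
  finally have "card (\<Union>uw\<in>set bad. E uw) \<le> 6" .
  moreover have "finite (\<Union>uw\<in>set bad. E uw)"
    using cS by (auto simp: E_def)
  ultimately have "\<not> S \<subseteq> (\<Union>uw\<in>set bad. E uw)"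
    using cS card_mono[of "\<Union>uw\<in>set bad. E uw" S] by linarith
  then obtain b3 where b3: "b3 \<in> S" and "\<forall>uw\<in>set bad. fst uw * int b3 \<noteq> snd uw"
    by (auto simp: E_def case_prod_beta)
  then have good: "p a1 b2 * int a2 * int b3 \<noteq> p a1 b1 * p a2 b2 - p a1 b2 * n"
    "p a2 b1 * int a1 * int b3 \<noteq> p a1 b1 * p a2 b2 - p a2 b1 * n"
    "(p a1 b2 * int a2 - p a2 b1 * int a1) * int b3 \<noteq> n * (p a2 b1 - p a1 b2)"
    "p a1 b1 * int a2 * int b3 \<noteq> p a1 b2 * p a2 b1 - p a1 b1 * n"
    "p a2 b2 * int a1 * int b3 \<noteq> p a1 b2 * p a2 b1 - p a2 b2 * n"
    "(p a1 b1 * int a2 - p a2 b2 * int a1) * int b3 \<noteq> n * (p a2 b2 - p a1 b1)"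
    by (auto simp: bad_def)
  have b3T: "b3 \<in> T" "b3 \<noteq> a1" "b3 \<noteq> a2" "b3 \<noteq> b1" "b3 \<noteq> b2" using b3 by (auto simp: S_def Beq)
  have p2: "p a1 b3 > 0" "p a2 b3 > 0" using posp inT b3T by (auto simp: p_def)
  \<comment> \<open>\<open>X\<close> and \<open>Y\<close> list the terms of positive and of negative
    sign in the determinant.\<close>
  define X where "X i = [p a1 b1 * p a2 b2, p a1 b2 * p a2 b3, p a1 b3 * p a2 b1] ! i" for i :: nat
  define Y where "Y i = [p a1 b1 * p a2 b3, p a1 b2 * p a2 b1, p a1 b3 * p a2 b2] ! i" for i :: nat
  have b3p: "p a b3 = int a * int b3 + n" for a by (simp add: p_def)
  have minor: "p a1 b * p a2 b' \<noteq> p a1 b' * p a2 b" if "b \<noteq> b'" for b b'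
    using minor_eq[of "int a1" "int b" n "int a2" "int b'"] that dB n by (auto simp: p_def)
  have sX: "X 0 \<noteq> X 1" "X 0 \<noteq> X 2" "X 1 \<noteq> X 2" "Y 0 \<noteq> Y 1" "Y 1 \<noteq> Y 2" "Y 0 \<noteq> Y 2"
    using good unfolding X_def Y_def by (auto simp: b3p algebra_simps)
  have pne: "p a b \<noteq> p a b'" if "b \<noteq> b'" "a \<in> T" for a b b' using that pos[of a] by (simp add: p_def)
  \<comment> \<open>Either \<open>X i\<close> and \<open>Y j\<close> share a factor and their other
    factors are distinct entries of one row, or they are the two products of a 2 by 2 minor.\<close>
  have XY: "X i \<noteq> Y j" if "i < 3" "j < 3" for i j
  proof -
    have "i = 0 \<or> i = 1 \<or> i = 2" "j = 0 \<or> j = 1 \<or> j = 2" using that by auto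
    then show ?thesis
      using minor[of b1 b2] minor[of b2 b3] minor[of b1 b3] b3T dB pne inT p2 p4
      by (auto simp: X_def Y_def)
  qed
  have root: "\<exists>x>0. p a b * p a' b' = int x ^ k"
    if "a \<in> T" "b \<in> T" "a' \<in> T" "b' \<in> T" "a \<noteq> b" "a' \<noteq> b'" for a b a' b'
  proof -
    obtain x x' where "x > 0" "x' > 0" "p a b = int x ^ k" "p a' b' = int x' ^ k"
      using ex \<open>a \<in> T\<close> \<open>b \<in> T\<close> \<open>a' \<in> T\<close> \<open>b' \<in> T\<close> \<open>a \<noteq> b\<close> \<open>a' \<noteq> b'\<close> unfolding p_def by metis
    then show ?thesis by (intro exI[of _ "x * x'"]) (auto simp: power_mult_distrib)
  qed
  have rX: "\<exists>x>0. X i = int x ^ k" if "i < 3" for i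
  proof -
    have "i = 0 \<or> i = 1 \<or> i = 2" using that by auto
    then show ?thesis using inT b3T dB by (auto simp: X_def intro!: root)
  qed
  have rY: "\<exists>x>0. Y i = int x ^ k" if "i < 3" for i
  proof -
    have "i = 0 \<or> i = 1 \<or> i = 2" using that by auto
    then show ?thesis using inT b3T dB by (auto simp: Y_def intro!: root)
  qed
  from rX obtain x where x: "\<And>i. i < 3 \<Longrightarrow> x i > 0 \<and> X i = int (x i) ^ k" by metis
  from rY obtain y where y: "\<And>i. i < 3 \<Longrightarrow> y i > 0 \<and> Y i = int (y i) ^ k" by metis
  have s3: "{..<3} = {0, 1, 2::nat}" by auto
  show False
  proof (rule no_equal_sums_of_three_powers[OF lps k, of x y])
    show "x i > 0 \<and> y i > 0" if "i < 3" for i using x y that by auto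
    have "x 0 \<noteq> x 1 \<and> x 0 \<noteq> x 2 \<and> x 1 \<noteq> x 2"
      using x[of 0] x[of 1] x[of 2] sX by auto
    then show "inj_on x {..<3}" by (auto simp: s3 inj_on_def)
    have "y 0 \<noteq> y 1 \<and> y 0 \<noteq> y 2 \<and> y 1 \<noteq> y 2"
      using y[of 0] y[of 1] y[of 2] sX by auto
    then show "inj_on y {..<3}" by (auto simp: s3 inj_on_def)
    have "x i \<noteq> y j" if "i < 3" "j < 3" for i j using XY[OF that] x y that by metis
    then show "x ` {..<3} \<inter> y ` {..<3} = {}" by (fastforce simp only: s3 lessThan_iff)
    have "X 0 + X 1 + X 2 = Y 0 + Y 1 + Y 2" by (simp add: X_def Y_def p_def algebra_simps)
    then have "int (x 0 ^ k + x 1 ^ k + x 2 ^ k) = int (y 0 ^ k + y 1 ^ k + y 2 ^ k)"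
      using x[of 0] x[of 1] x[of 2] y[of 0] y[of 1] y[of 2] by simp
    then have "x 0 ^ k + x 1 ^ k + x 2 ^ k = y 0 ^ k + y 1 ^ k + y 2 ^ k"
      by (simp only: of_nat_eq_iff)
    then show "(\<Sum>i<3. x i ^ k) = (\<Sum>i<3. y i ^ k)" by (simp add: s3 add.assoc)
  qed
qed


section \<open>Primality of the affine equation\<close>

text \<open>The conic \<open>a0 x^2 + a1 x y + a2 y^2 + b0 x z + b1 y z + c z^2\<close> misses the
  vertices of the coordinate triangle, meets each side in two distinct geometric points and is
  nonsingular; the expression in \<open>det\<close> is half the Hessian determinant.\<close>

locale smooth_conic =
  fixes a0 a1 a2 b0 b1 c :: "'a::field_char_0"
  assumes vertex: "a0 \<noteq> 0" "a2 \<noteq> 0" "c \<noteq> 0"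
    and edge: "a1\<^sup>2 \<noteq> 4 * a0 * a2" "b0\<^sup>2 \<noteq> 4 * a0 * c" "b1\<^sup>2 \<noteq> 4 * a2 * c"
    and det: "4 * a0 * a2 * c + a1 * b0 * b1 - a0 * b1\<^sup>2 - a2 * b0\<^sup>2 - c * a1\<^sup>2 \<noteq> 0"

lemma (in smooth_conic) smooth_conic_swap: "smooth_conic a2 a1 a0 b1 b0 c"
  using vertex edge det by unfold_locales (auto simp: algebra_simps)

text \<open>A quadratic polynomial in \<open>x ^ k\<close>. The coefficient ring is general because
  the construction gets nested: coefficients in \<open>\<complex>\<close> and in
  \<open>\<complex>[v]\<close> both occur.\<close>

definition trinomial :: "nat \<Rightarrow> 'a \<Rightarrow> 'a \<Rightarrow> 'a \<Rightarrow> 'a::comm_ring_1 poly" where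
  "trinomial k p q r = [:p:] + monom q k + monom r (2 * k)"

lemma poly_trinomial: "poly (trinomial k p q r) x = p + q * x ^ k + r * x ^ (2 * k)"
  by (simp add: trinomial_def poly_monom)

lemma coeff_trinomial:
  "k > 0 \<Longrightarrow> coeff (trinomial k p q r) i =
    (if i = 0 then p else if i = k then q else if i = 2 * k then r else 0)"
  by (auto simp: trinomial_def coeff_pCons split: nat.splits)

lemma degree_trinomial: "k > 0 \<Longrightarrow> r \<noteq> 0 \<Longrightarrow> degree (trinomial k p q r) = 2 * k"
  by (intro antisym degree_le le_degree) (auto simp: coeff_trinomial)

text \<open>Roots are nonzero as \<open>p \<noteq> 0\<close>, so a multiple root \<open>x\<close>
  would make \<open>x ^ k\<close> a double root of \<open>p + q y + r y^2\<close>, against the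
  discriminant.\<close>

lemma trinomial_simple_root:
  fixes p q r :: complex
  assumes "k > 0" "p \<noteq> 0" "r \<noteq> 0" "q\<^sup>2 \<noteq> 4 * p * r" "poly (trinomial k p q r) x = 0"
  shows "poly (pderiv (trinomial k p q r)) x \<noteq> 0"
proof
  assume d: "poly (pderiv (trinomial k p q r)) x = 0"
  have x: "x \<noteq> 0" using assms by (auto simp: poly_trinomial power_0_left)
  have "of_nat k * q * x ^ (k - 1) + of_nat (2 * k) * r * x ^ (2 * k - 1) = 0"
    using d by (simp add: trinomial_def pderiv_add pderiv_monom poly_monom pderiv_pCons)
  also have "2 * k - 1 = (k - 1) + k" using \<open>k > 0\<close> by simp
  finally have "of_nat k * x ^ (k - 1) * (q + 2 * r * x ^ k) = 0"
    by (simp add: power_add algebra_simps)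
  then have q: "q = - 2 * r * x ^ k" using x \<open>k > 0\<close> by (simp add: add_eq_0_iff)
  define y where "y = x ^ k"
  have "p + q * y + r * (y * y) = 0"
    using assms(5) by (simp add: poly_trinomial y_def mult_2 power_add)
  then have p: "p = - (q * y) - r * (y * y)" by (simp add: eq_diff_eq eq_neg_iff_add_eq_0 add_ac)
  have "q\<^sup>2 = 4 * p * r"
    unfolding p q y_def[symmetric] by (simp add: power2_eq_square algebra_simps)
  then show False using assms(4) by simp
qed

lemma trinomial_root_exists:
  fixes p q r :: complex
  assumes "k > 0" "r \<noteq> 0"
  obtains x where "poly (trinomial k p q r) x = 0"
proof -
  have "degree (trinomial k p q r) > 0" using assms by (simp add: degree_trinomial)
  then have "\<not> constant (poly (trinomial k p q r))" by (simp add: constant_degree)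
  then show ?thesis using fundamental_theorem_of_algebra that by blast
qed

lemma card_roots_trinomial:
  fixes p q r :: complex
  assumes "k > 0" "p \<noteq> 0" "r \<noteq> 0" "q\<^sup>2 \<noteq> 4 * p * r"
  shows "card {x. poly (trinomial k p q r) x = 0} = 2 * k"
proof -
  let ?p = "trinomial k p q r"
  have deg: "degree ?p = 2 * k" using assms by (simp add: degree_trinomial)
  have "rsquarefree ?p"
    unfolding rsquarefree_roots using trinomial_simple_root[OF assms] by blast
  then have "degree (smult (lead_coeff ?p) (\<Prod>z|poly ?p z = 0. [:-z, 1:])) = degree ?p"
    by (simp only: complex_poly_decompose_rsquarefree)
  moreover have "degree (\<Prod>z|poly ?p z = 0. [:-z, 1:]) = (\<Sum>z|poly ?p z = 0. degree [:-z, 1:])"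
    by (intro degree_prod_sum_eq) auto
  moreover have "lead_coeff ?p \<noteq> 0" using deg assms by (simp add: coeff_trinomial)
  ultimately show ?thesis using deg by simp
qed

lemma poly_eq_0_if_card_roots:
  fixes p :: "'a::idom poly"
  assumes "S \<subseteq> {x. poly p x = 0}" "card S = d" "p = 0 \<or> degree p < d"
  shows "p = 0"
proof (rule ccontr)
  assume p: "p \<noteq> 0"
  then have "card S \<le> card {x. poly p x = 0}" using assms(1) by (intro card_mono poly_roots_finite)
  also have "\<dots> \<le> degree p" using p by (rule card_poly_roots_bound)
  finally show False using assms(2,3) p by simp
qed

lemma primitive_root_of_unity_exists:
  assumes "k > 0"
  obtains \<zeta> :: complex where "\<zeta> ^ k = 1" "\<And>j. \<zeta> ^ j = 1 \<Longrightarrow> k dvd j"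
proof
  define \<zeta> where "\<zeta> = cis (2 * pi / k)"
  have pw: "\<zeta> ^ j = cis (2 * pi * j / k)" for j by (simp add: \<zeta>_def DeMoivre mult_ac)
  show k1: "\<zeta> ^ k = 1" using assms by (simp add: pw)
  fix j assume "\<zeta> ^ j = 1"
  have "\<zeta> ^ j = (\<zeta> ^ k) ^ (j div k) * \<zeta> ^ (j mod k)"
    by (simp flip: power_mult power_add)
  then have "\<zeta> ^ (j mod k) = 1" using k1 \<open>\<zeta> ^ j = 1\<close> by simp
  then have "cis (2 * pi * real (j mod k) / k) = cis (2 * pi * real 0 / k)" using pw[of "j mod k"] by simp
  then have "j mod k = 0"
    using bij_betw_imp_inj_on[OF bij_betw_roots_unity[OF assms]] assms by (auto simp: inj_on_def)
  then show "k dvd j" by auto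
qed

text \<open>A multiplicative map into a domain kills a product only by killing a factor. With
  evaluation at a point as \<open>\<phi>\<close> this selects a prime factor through that
  point.\<close>

lemma prime_factor_with_zero_image:
  fixes \<phi> :: "'a::factorial_semiring \<Rightarrow> 'b::idom"
  assumes "\<And>x y. \<phi> (x * y) = \<phi> x * \<phi> y" "\<phi> 1 = 1" "x \<noteq> 0" "\<phi> x = 0"
  obtains p where "prime_elem p" "p dvd x" "\<phi> p = 0"
proof -
  obtain A where A: "\<And>p. p \<in># A \<Longrightarrow> prime p" "normalize (prod_mset A) = normalize x"
    using prime_factorization_exists'[OF \<open>x \<noteq> 0\<close>] by blast
  then have "x dvd prod_mset A" "prod_mset A dvd x" by (metis associatedD1, metis associatedD2)
  then obtain y where "prod_mset A = x * y" by (elim dvdE)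
  then have "\<phi> (prod_mset A) = 0" using assms by simp
  moreover have "\<phi> (prod_mset B) = 0 \<Longrightarrow> \<exists>p\<in>#B. \<phi> p = 0" for B
    by (induction B) (auto simp: assms)
  ultimately obtain p where "p \<in># A" "\<phi> p = 0" by blast
  moreover have "p dvd x" using \<open>p \<in># A\<close> \<open>prod_mset A dvd x\<close> dvd_prod_mset dvd_trans by blast
  ultimately show ?thesis using that A by (auto simp: prime_imp_prime_elem)
qed

text \<open>The part \<open>u = 1\<close> of the curve \<open>Q(u\<^sup>k, v\<^sup>k, w\<^sup>k) = 0\<close>, where \<open>Q\<close> is the quadratic form
  \<open>a0 x\<^sup>2 + a1 x y + a2 y\<^sup>2 + b0 x z + b1 y z + c z\<^sup>2\<close>, as a polynomial in \<open>w\<close> over \<open>\<complex>[v]\<close>.\<close>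

definition affine_curve ::
  "nat \<Rightarrow> complex \<Rightarrow> complex \<Rightarrow> complex \<Rightarrow> complex \<Rightarrow> complex \<Rightarrow> complex \<Rightarrow> complex poly poly" where
  "affine_curve k a0 a1 a2 b0 b1 c =
     trinomial k (trinomial k a0 a1 a2) (trinomial k b0 b1 0) [:c:]"

text \<open>The substitution of \<open>\<zeta> w\<close> for \<open>w\<close>.\<close>

definition twist :: "complex \<Rightarrow> complex poly poly \<Rightarrow> complex poly poly" where
  "twist \<zeta> p = pcompose p [:0, [:\<zeta>:]:]"

lemma coeff_twist: "coeff (twist \<zeta> p) i = [:\<zeta> ^ i:] * coeff p i"
  by (simp add: twist_def coeff_pcompose_linear poly_const_pow)

lemma twist_mult: "twist \<zeta> (p * q) = twist \<zeta> p * twist \<zeta> q"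
  by (simp add: twist_def pcompose_mult)

lemma coeff_twist_fixed:
  assumes "\<And>j. \<zeta> ^ j = 1 \<Longrightarrow> k dvd j" "twist \<zeta> p = p" "coeff p j \<noteq> 0"
  shows "k dvd j"
proof -
  have "[:\<zeta> ^ j:] * coeff p j = 1 * coeff p j" using assms(2) coeff_twist by (metis mult_1)
  then have "[:\<zeta> ^ j:] = 1" using assms(3) mult_right_cancel by blast
  then show ?thesis using assms(1) by (simp add: one_pCons)
qed

locale smooth_conic_complex = smooth_conic a0 a1 a2 b0 b1 c for a0 a1 a2 b0 b1 c :: complex +
  fixes k :: nat
  assumes k: "k > 0"
begin

text \<open>\<open>F = A + B w^k + c w^(2k)\<close>, and \<open>D\<close> is its discriminant
  \<open>B^2 - 4 c A\<close> as a quadratic polynomial in \<open>w^k\<close>, expanded in powers of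
  \<open>v\<close>.\<close>

abbreviation "A \<equiv> trinomial k a0 a1 a2"
abbreviation "B \<equiv> trinomial k b0 b1 0"
abbreviation "F \<equiv> affine_curve k a0 a1 a2 b0 b1 c"
abbreviation "D \<equiv> trinomial k (b0\<^sup>2 - 4 * c * a0) (2 * b0 * b1 - 4 * c * a1) (b1\<^sup>2 - 4 * c * a2)"

lemma D_eq: "D = B\<^sup>2 - [:4 * c:] * A"
proof -
  have "poly D x = poly (B\<^sup>2 - [:4 * c:] * A) x" for x
  proof -
    define y where "y = x ^ k"
    have "x ^ (2 * k) = y * y" by (simp add: y_def mult_2 power_add)
    then show ?thesis
      by (simp add: poly_trinomial power2_eq_square algebra_simps flip: y_def)
  qed
  then show ?thesis using poly_eq_poly_eq_iff[of D "B\<^sup>2 - [:4 * c:] * A"] by blast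
qed

text \<open>The outer coefficients are nonzero by \<open>edge\<close>, and the discriminant of
  \<open>D\<close> in \<open>v^k\<close> is \<open>-16 c\<close> times the determinant of the conic.
  So \<open>trinomial_simple_root\<close> applies to \<open>D\<close>.\<close>

lemma D_coeffs:
  "b0\<^sup>2 - 4 * c * a0 \<noteq> 0" "b1\<^sup>2 - 4 * c * a2 \<noteq> 0"
  "(2 * b0 * b1 - 4 * c * a1)\<^sup>2 \<noteq> 4 * (b0\<^sup>2 - 4 * c * a0) * (b1\<^sup>2 - 4 * c * a2)"
proof -
  show "b0\<^sup>2 - 4 * c * a0 \<noteq> 0" "b1\<^sup>2 - 4 * c * a2 \<noteq> 0" using edge by (auto simp: mult_ac)
  have "(2 * b0 * b1 - 4 * c * a1)\<^sup>2 - 4 * (b0\<^sup>2 - 4 * c * a0) * (b1\<^sup>2 - 4 * c * a2) =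
    - 16 * c * (4 * a0 * a2 * c + a1 * b0 * b1 - a0 * b1\<^sup>2 - a2 * b0\<^sup>2 - c * a1\<^sup>2)"
    by (simp add: power2_eq_square algebra_simps)
  then show "(2 * b0 * b1 - 4 * c * a1)\<^sup>2 \<noteq> 4 * (b0\<^sup>2 - 4 * c * a0) * (b1\<^sup>2 - 4 * c * a2)"
    using det vertex by auto
qed

lemma degree_F: "degree F = 2 * k"
  using k vertex by (simp add: affine_curve_def degree_trinomial)

text \<open>Over a root \<open>\<rho>\<close> of \<^term>\<open>A\<close> the only prime factor of \<^term>\<open>F\<close> through \<open>(\<rho>, 0)\<close> is invariant under
  \<open>w \<mapsto> \<zeta> w\<close>, hence a polynomial in \<open>w\<^sup>k\<close>. If it were proper, the discriminant \<^term>\<open>D\<close> of \<^term>\<open>F\<close>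
  in \<open>w\<^sup>k\<close> would be a square, but all roots of \<^term>\<open>D\<close> are simple.\<close>

lemma prime_elem_F: "prime_elem F"
proof -
  have F0: "F \<noteq> 0" using degree_F k by auto
  have cF: "coeff F i = (if i = 0 then A else if i = k then B else if i = 2 * k then [:c:] else 0)" for i
    using k by (simp add: affine_curve_def coeff_trinomial)
  obtain \<rho> where \<rho>: "poly A \<rho> = 0" using trinomial_root_exists k vertex by metis
  then have simple: "poly (pderiv A) \<rho> \<noteq> 0"
    using trinomial_simple_root k vertex edge by metis
  have A0: "A \<noteq> 0" using simple by auto
  obtain P where P: "prime_elem P" "P dvd F" "poly (coeff P 0) \<rho> = 0"
    using prime_factor_with_zero_image[of "\<lambda>p. poly (coeff p 0) \<rho>" F] F0 \<rho>
    by (auto simp: cF coeff_mult_0)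
  then obtain R where R: "F = P * R" by (elim dvdE)
  have PR0: "coeff P 0 * coeff R 0 = A" using R cF[of 0] by (simp add: coeff_mult_0)
  \<comment> \<open>The product of the two constant coefficients is \<open>A\<close>, of which
    \<open>\<rho>\<close> is a simple root, so it cannot be a root of both.\<close>
  have R\<rho>: "poly (coeff R 0) \<rho> \<noteq> 0"
  proof
    assume "poly (coeff R 0) \<rho> = 0"
    then have "poly (pderiv (coeff P 0 * coeff R 0)) \<rho> = 0" using P(3) by (simp add: pderiv_mult)
    then show False using simple PR0 by simp
  qed
  obtain \<zeta> :: complex where \<zeta>: "\<zeta> ^ k = 1" "\<And>j. \<zeta> ^ j = 1 \<Longrightarrow> k dvd j"
    using primitive_root_of_unity_exists[OF k] by metis
  have "coeff (twist \<zeta> F) i = coeff F i" for i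
    using \<zeta>(1) k by (auto simp: coeff_twist cF power_mult mult.commute[of 2] one_pCons)
  then have twF: "twist \<zeta> F = F" by (rule poly_eqI)
  then have "P dvd twist \<zeta> P * twist \<zeta> R" using P(2) R by (simp add: twist_mult)
  \<comment> \<open>\<open>twist\<close> fixes the constant coefficient in \<open>w\<close>, so
    \<open>twist \<zeta> R\<close>, unlike \<open>P\<close>, does not vanish at
    \<open>(\<rho>, 0)\<close>.\<close>
  moreover have "\<not> P dvd twist \<zeta> R"
  proof
    assume "P dvd twist \<zeta> R"
    then obtain q where "twist \<zeta> R = P * q" by (elim dvdE)
    then have "coeff (twist \<zeta> R) 0 = coeff P 0 * coeff q 0" by (simp add: coeff_mult_0)
    then show False using R\<rho> P(3) by (simp add: coeff_twist)
  qed
  ultimately have "P dvd twist \<zeta> P" using P(1) prime_elem_dvd_mult_iff by blast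
  then obtain u where u: "twist \<zeta> P = P * u" by (elim dvdE)
  have P0: "P \<noteq> 0" "R \<noteq> 0" using F0 R by auto
  have "\<zeta> \<noteq> 0" using \<zeta>(1) k by (auto simp: power_0_left)
  then have "degree (twist \<zeta> P) = degree P"
    by (simp add: degree_pcompose twist_def)
  moreover have "twist \<zeta> P \<noteq> 0" using twF R F0 by (auto simp: twist_mult)
  ultimately have "degree u = 0" using u P0 by (auto simp: degree_mult_eq)
  then obtain u0 where u0: "u = [:u0:]" by (metis degree_eq_zeroE)
  \<comment> \<open>Comparing constant coefficients turns invariance up to a factor into exact
    invariance.\<close>
  have "coeff P 0 * 1 = coeff P 0 * u0"
    using arg_cong[OF u, of "\<lambda>p. coeff p 0"] by (simp add: coeff_twist u0 coeff_mult_0)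
  moreover have "coeff P 0 \<noteq> 0" using PR0 A0 by auto
  ultimately have "u0 = 1" by (metis mult_left_cancel)
  then have twP: "twist \<zeta> P = P" using u by (simp add: u0 flip: one_pCons)
  have "P * twist \<zeta> R = twist \<zeta> (P * R)" by (simp only: twist_mult twP)
  then have "P * twist \<zeta> R = P * R" by (simp only: twF flip: R)
  then have twR: "twist \<zeta> R = R" using P0 by simp
  have degs: "degree P + degree R = 2 * k" using degree_F R P0 by (simp add: degree_mult_eq)
  have lc: "lead_coeff P * lead_coeff R = [:c:]"
    using R degree_F cF[of "2 * k"] k lead_coeff_mult[of P R] by simp
  have "is_unit [:c:]" using vertex by (simp add: is_unit_const_poly_iff dvd_field_iff)
  then have lcu: "is_unit (lead_coeff P)" "is_unit (lead_coeff R)"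
    using lc by (metis dvd_mult_left dvd_mult_right dvd_refl dvd_trans)+
  have unit: "is_unit p" if "degree p = 0" "is_unit (lead_coeff p)" for p :: "complex poly poly"
    using that by (metis degree_eq_zeroE is_unit_const_poly_iff lead_coeff_pCons(2))
  have "k dvd degree P" using coeff_twist_fixed[OF \<zeta>(2) twP] P0 by simp
  then obtain m where m: "degree P = k * m" by (elim dvdE)
  then have "k * m \<le> k * 2" using degs by linarith
  then have "m \<le> 2" using k by simp
  \<comment> \<open>\<open>m = 0\<close> would make \<open>P\<close> a unit, and
    \<open>m = 2\<close> makes \<open>R\<close> one, since leading coefficients divide the constant
    \<open>c\<close>. Only \<open>m = 1\<close> is a proper factorization.\<close>
  then consider "m = 0" | "m = 1" | "m = 2" by linarith
  then show ?thesis
  proof cases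
    case 1
    then show ?thesis using unit[of P] m lcu P(1) by (simp add: prime_elem_not_unit)
  next
    case 3
    then have "is_unit R" using unit[of R] m degs lcu by simp
    then show ?thesis using P(1) R prime_elem_mult_unit_left by (metis mult.commute)
  next
    case 2
    then have dP: "degree P = k" and dR: "degree R = k" using m degs by auto
    have form: "p = [:coeff p 0:] + monom (coeff p k) k" if "degree p = k" "twist \<zeta> p = p" for p
    proof (rule poly_eqI)
      fix i
      have "coeff p i = 0" if "i \<noteq> 0" "i \<noteq> k"
      proof (rule ccontr)
        assume "coeff p i \<noteq> 0"
        then have "k dvd i" "i \<le> k"
          using coeff_twist_fixed[OF \<zeta>(2) \<open>twist \<zeta> p = p\<close>] \<open>degree p = k\<close> le_degree by auto
        then show False using that by (auto dest: dvd_imp_le)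
      qed
      then show "coeff p i = coeff ([:coeff p 0:] + monom (coeff p k) k) i"
        using k by (auto simp: coeff_pCons split: nat.splits)
    qed
    define s0 s1 t0 t1 where "s0 = coeff P 0" "s1 = coeff P k" "t0 = coeff R 0" "t1 = coeff R k"
    note st = this
    have "P * R = ([:s0:] + monom s1 k) * ([:t0:] + monom t1 k)"
      using form[OF dP twP] form[OF dR twR] by (simp add: st)
    also have "\<dots> = [:s0 * t0:] + monom (s0 * t1 + s1 * t0) k + monom (s1 * t1) (2 * k)"
      by (simp add: algebra_simps mult_monom smult_monom mult_2 mult_2_right flip: add_monom)
    finally have tri: "F = trinomial k (s0 * t0) (s0 * t1 + s1 * t0) (s1 * t1)"
      unfolding R trinomial_def .
    have "A = coeff F 0" "B = coeff F k" "[:c:] = coeff F (2 * k)" using k by (simp_all add: cF)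
    then have "A = s0 * t0" "B = s0 * t1 + s1 * t0" "[:c:] = s1 * t1"
      using k by (simp_all only: tri coeff_trinomial) simp_all
    moreover have "[:4 * c:] = 4 * [:c:]" by (simp add: numeral_poly)
    ultimately have "D = (s0 * t1 + s1 * t0)\<^sup>2 - 4 * (s1 * t1) * (s0 * t0)"
      by (simp only: D_eq)
    also have "\<dots> = (s0 * t1 - s1 * t0)\<^sup>2" by (simp add: power2_eq_square algebra_simps)
    finally have Dsq: "D = (s0 * t1 - s1 * t0)\<^sup>2" .
    obtain x where x: "poly D x = 0" using trinomial_root_exists[OF k] D_coeffs by metis
    then have "poly (s0 * t1 - s1 * t0) x = 0" by (simp only: Dsq poly_power power_eq_0_iff)
    then have "poly (pderiv ((s0 * t1 - s1 * t0)\<^sup>2)) x = 0"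
      by (simp add: power2_eq_square pderiv_mult)
    then have "poly (pderiv D) x = 0" by (simp only: Dsq)
    then show ?thesis using trinomial_simple_root[OF k _ _ _ x] D_coeffs by simp
  qed
qed

text \<open>For almost all \<open>v\<close> the specialization of \<^term>\<open>F\<close> has \<open>2 k\<close> distinct roots \<open>w\<close>, all of which are roots
  of the remainder of \<open>P\<close> modulo \<^term>\<open>F\<close>.\<close>

lemma F_dvd_if_zeros_subset:
  assumes zeros: "\<And>v w. poly (poly F [:w:]) v = 0 \<Longrightarrow> poly (poly P [:w:]) v = 0"
  shows "F dvd P"
proof -
  have F0: "F \<noteq> 0" using degree_F k by auto
  \<comment> \<open>The leading coefficient of \<open>F\<close> in \<open>w\<close> is the constant
    \<open>c\<close>, so its power introduced by pseudo-division can be cancelled at the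
    end.\<close>
  obtain q r where qr: "pseudo_divmod P F = (q, r)" by fastforce
  define e where "e = Suc (degree P) - degree F"
  have lcF: "lead_coeff F = [:c:]" using degree_F k by (simp add: affine_curve_def coeff_trinomial)
  have eq: "smult ([:c:] ^ e) P = F * q + r" and dr: "r = 0 \<or> degree r < degree F"
    using pseudo_divmod[OF F0 qr] lcF by (auto simp: e_def)
  have coeffs0: "poly (coeff r j) v = 0" if v: "poly A v \<noteq> 0" "poly D v \<noteq> 0" for v j
  proof -
    define p where "p = map_poly (\<lambda>s. poly s v) r"
    have ev: "poly (map_poly (\<lambda>s. poly s v) s) w = poly (poly s [:w:]) v" for s w
      by (induction s) (auto simp: map_poly_pCons)
    have zF: "poly (poly F [:w:]) v = poly (trinomial k (poly A v) (poly B v) c) w" for w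
      by (simp add: affine_curve_def poly_trinomial poly_const_pow)
    have "poly p w = 0" if "poly (trinomial k (poly A v) (poly B v) c) w = 0" for w
    proof -
      have "poly (poly (smult ([:c:] ^ e) P) [:w:]) v = poly (poly (F * q + r) [:w:]) v"
        by (simp only: eq)
      then show ?thesis using zeros[of w v] that zF by (simp add: p_def ev)
    qed
    then have "{w. poly (trinomial k (poly A v) (poly B v) c) w = 0} \<subseteq> {w. poly p w = 0}" by auto
    moreover have "card {w. poly (trinomial k (poly A v) (poly B v) c) w = 0} = 2 * k"
    proof (rule card_roots_trinomial)
      show "(poly B v)\<^sup>2 \<noteq> 4 * poly A v * c" using v(2) unfolding D_eq by (auto simp: mult_ac)
    qed (use k vertex v in auto)
    moreover have "p = 0 \<or> degree p < 2 * k"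
      using dr degree_F map_poly_degree_leq[of "\<lambda>s. poly s v" r] by (auto simp: p_def)
    ultimately have "p = 0" by (rule poly_eq_0_if_card_roots)
    then show "poly (coeff r j) v = 0"
      using coeff_map_poly[of "\<lambda>s. poly s v" r j] by (simp add: p_def)
  qed
  have "degree A \<noteq> 0" "degree D \<noteq> 0"
    using k by (simp_all only: degree_trinomial[OF k vertex(2)] degree_trinomial[OF k D_coeffs(2)])
  then have "A * D \<noteq> 0" by (metis degree_0 mult_eq_0_iff)
  then have fin: "finite {v. poly (A * D) v = 0}" by (rule poly_roots_finite)
  have "coeff r j = 0" for j
  proof (rule ccontr)
    assume "coeff r j \<noteq> 0"
    then have "finite {v. poly (coeff r j) v = 0}" by (rule poly_roots_finite)
    moreover have "UNIV \<subseteq> {v. poly (A * D) v = 0} \<union> {v. poly (coeff r j) v = 0}"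
      using coeffs0 by auto
    ultimately show False using fin by (metis finite_Un finite_subset infinite_UNIV_char_0)
  qed
  then have "r = 0" by (simp add: poly_eqI)
  then have "[:[:c ^ e:]:] * P = F * q" using eq by (simp add: poly_const_pow)
  then have "[:[:inverse (c ^ e):]:] * ([:[:c ^ e:]:] * P) = F * ([:[:inverse (c ^ e):]:] * q)"
    by (simp only: mult_ac)
  then have "P = F * ([:[:inverse (c ^ e):]:] * q)" using vertex by (simp add: one_pCons[symmetric])
  then show ?thesis by (rule dvdI)
qed

lemma zero_product_imp_zero_factor:
  assumes "\<And>v w. poly (poly F [:w:]) v = 0 \<Longrightarrow> poly (poly G [:w:]) v * poly (poly H [:w:]) v = 0"
  shows "(\<forall>v w. poly (poly F [:w:]) v = 0 \<longrightarrow> poly (poly G [:w:]) v = 0) \<or>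
         (\<forall>v w. poly (poly F [:w:]) v = 0 \<longrightarrow> poly (poly H [:w:]) v = 0)"
proof -
  have "F dvd G * H" using assms by (intro F_dvd_if_zeros_subset) simp
  then have "F dvd G \<or> F dvd H" using prime_elem_F prime_elem_dvd_mult_iff by blast
  then show ?thesis by (auto elim!: dvdE)
qed

end


section \<open>Smoothness and irreducibility of the plane curve\<close>

definition mon3 :: "nat \<Rightarrow> nat \<Rightarrow> nat \<Rightarrow> monom_exp" where
  "mon3 i j l = Poly_Mapping.single 0 i + Poly_Mapping.single 1 j + Poly_Mapping.single 2 l"

lemma lookup_mon3:
  "Poly_Mapping.lookup (mon3 i j l) n = (if n = 0 then i else if n = 1 then j else if n = 2 then l else 0)"
  by (auto simp: mon3_def lookup_add lookup_single when_def)

lemma mon3_minus_single: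
  "mon3 i j l - Poly_Mapping.single 0 (Suc 0) = mon3 (i - 1) j l"
  "mon3 i j l - Poly_Mapping.single (Suc 0) (Suc 0) = mon3 i (j - 1) l"
  "mon3 i j l - Poly_Mapping.single 2 (Suc 0) = mon3 i j (l - 1)"
  by (auto intro!: poly_mapping_eqI simp: lookup_mon3 lookup_minus lookup_single when_def)

lemma mpoly_eval_superset:
  assumes "finite S" "Poly_Mapping.keys p \<subseteq> S"
  shows "mpoly_eval x p = (\<Sum>m\<in>S. Poly_Mapping.lookup p m *
    (\<Prod>i \<in> Poly_Mapping.keys m. x i ^ Poly_Mapping.lookup m i))"
  unfolding mpoly_eval_def using assms
  by (intro sum.mono_neutral_left) (auto simp: in_keys_iff)

lemma mpoly_eval_add: "mpoly_eval x (p + q) = mpoly_eval x p + mpoly_eval x q"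
  using mpoly_eval_superset[of "Poly_Mapping.keys p \<union> Poly_Mapping.keys q" "p + q" x]
    mpoly_eval_superset[of "Poly_Mapping.keys p \<union> Poly_Mapping.keys q" p x]
    mpoly_eval_superset[of "Poly_Mapping.keys p \<union> Poly_Mapping.keys q" q x] keys_add[of p q]
  by (simp add: lookup_add distrib_right sum.distrib)

lemma mpoly_eval_0: "mpoly_eval x 0 = 0"
  by (simp add: mpoly_eval_def)

lemma prod_keys_superset:
  fixes x :: "nat \<Rightarrow> 'a::comm_semiring_1"
  assumes "finite S" "Poly_Mapping.keys m \<subseteq> S"
  shows "(\<Prod>i \<in> Poly_Mapping.keys m. x i ^ Poly_Mapping.lookup m i) =
    (\<Prod>i \<in> S. x i ^ Poly_Mapping.lookup m i)"
  using assms by (intro prod.mono_neutral_left) (auto simp: in_keys_iff)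

lemma atMost_2: "{..2::nat} = {0, 1, 2}"
  by auto

lemma mpoly_eval_mpolys_2:
  assumes "p \<in> mpolys 2"
  shows "mpoly_eval x p = (\<Sum>m \<in> Poly_Mapping.keys p. Poly_Mapping.lookup p m * (x 0 ^ Poly_Mapping.lookup m 0
     * x 1 ^ Poly_Mapping.lookup m 1 * x 2 ^ Poly_Mapping.lookup m 2))"
  unfolding mpoly_eval_def
proof (intro sum.cong refl arg_cong2[of _ _ _ _ "(*)"])
  fix m assume "m \<in> Poly_Mapping.keys p"
  then have "Poly_Mapping.keys m \<subseteq> {..2}" using assms by (auto simp: mpolys_def)
  from prod_keys_superset[OF _ this]
  show "(\<Prod>i \<in> Poly_Mapping.keys m. x i ^ Poly_Mapping.lookup m i) =
     x 0 ^ Poly_Mapping.lookup m 0 * x 1 ^ Poly_Mapping.lookup m 1 * x 2 ^ Poly_Mapping.lookup m 2"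
    by (simp add: atMost_2 mult_ac)
qed

lemma single_mon3_in_forms: "Poly_Mapping.single (mon3 i j l) a \<in> forms 2 (i + j + l)"
proof -
  have "Poly_Mapping.keys (mon3 i j l) \<subseteq> {..2}"
    by (auto simp: in_keys_iff lookup_mon3 split: if_splits)
  then show ?thesis by (auto simp: forms_def mpolys_def atMost_2 lookup_mon3 split: if_splits)
qed

lemma forms_subset_mpolys: "forms N d \<subseteq> mpolys N"
  by (auto simp: forms_def)

lemma mpoly_eval_single_mon3:
  "mpoly_eval x (Poly_Mapping.single (mon3 i j l) a) = a * (x 0 ^ i * x 1 ^ j * x 2 ^ l)"
proof -
  have "Poly_Mapping.single (mon3 i j l) a \<in> mpolys 2"
    using single_mon3_in_forms forms_subset_mpolys by (rule subsetD[rotated])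
  then show ?thesis by (simp add: mpoly_eval_mpolys_2 lookup_mon3)
qed

lemma mpoly_eval_scale:
  assumes "p \<in> forms N d"
  shows "mpoly_eval (\<lambda>i. c * x i) p = c ^ d * mpoly_eval x p"
proof -
  have "(\<Prod>i \<in> Poly_Mapping.keys m. (c * x i) ^ Poly_Mapping.lookup m i) =
    c ^ d * (\<Prod>i \<in> Poly_Mapping.keys m. x i ^ Poly_Mapping.lookup m i)" if "m \<in> Poly_Mapping.keys p" for m
  proof -
    have m: "Poly_Mapping.keys m \<subseteq> {..N}" "(\<Sum>i\<le>N. Poly_Mapping.lookup m i) = d"
      using that assms by (auto simp: forms_def mpolys_def)
    have "(\<Prod>i\<le>N. c ^ Poly_Mapping.lookup m i) = c ^ d" by (simp add: m(2) flip: power_sum)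
    then show ?thesis
      using prod_keys_superset[OF _ m(1), of x] prod_keys_superset[OF _ m(1), of "\<lambda>i. c * x i"]
      by (simp add: power_mult_distrib prod.distrib)
  qed
  then show ?thesis by (simp add: mpoly_eval_def sum_distrib_left mult_ac)
qed

lemma forms_add: "p \<in> forms N d \<Longrightarrow> q \<in> forms N d \<Longrightarrow> p + q \<in> forms N d"
  for p q :: "'a::comm_monoid_add mpoly"
  using keys_add[of p q] unfolding forms_def mpolys_def by blast

text \<open>\<open>Q(x0^k, x1^k, x2^k)\<close> for the quadratic form \<open>Q\<close> of
  \<open>smooth_conic\<close>, with the same order of coefficients.\<close>

definition conic_form :: "nat \<Rightarrow> 'a \<Rightarrow> 'a \<Rightarrow> 'a \<Rightarrow> 'a \<Rightarrow> 'a \<Rightarrow> 'a \<Rightarrow> 'a::comm_semiring_1 mpoly" where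
  "conic_form k a0 a1 a2 b0 b1 c =
     Poly_Mapping.single (mon3 (2 * k) 0 0) a0 + Poly_Mapping.single (mon3 k k 0) a1
     + Poly_Mapping.single (mon3 0 (2 * k) 0) a2 + Poly_Mapping.single (mon3 k 0 k) b0
     + Poly_Mapping.single (mon3 0 k k) b1 + Poly_Mapping.single (mon3 0 0 (2 * k)) c"

lemma conic_form_in_forms: "conic_form k a0 a1 a2 b0 b1 c \<in> forms 2 (2 * k)"
proof -
  have "Poly_Mapping.single (mon3 i j l) a \<in> forms 2 (2 * k)" if "i + j + l = 2 * k" for i j l and a :: 'a
    using single_mon3_in_forms[of i j l a] that by simp
  then show ?thesis unfolding conic_form_def by (intro forms_add) simp_all
qed

lemma mpoly_eval_conic_form:
  "mpoly_eval x (conic_form k a0 a1 a2 b0 b1 c) =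
     a0 * x 0 ^ (2 * k) + a1 * (x 0 ^ k * x 1 ^ k) + a2 * x 1 ^ (2 * k)
     + b0 * (x 0 ^ k * x 2 ^ k) + b1 * (x 1 ^ k * x 2 ^ k) + c * x 2 ^ (2 * k)"
  by (simp add: conic_form_def mpoly_eval_add mpoly_eval_single_mon3)

lemma lookup_mpoly_to_complex: "Poly_Mapping.lookup (mpoly_to_complex p) m = of_rat (Poly_Mapping.lookup p m)"
  by (simp add: mpoly_to_complex_def Poly_Mapping.map.rep_eq when_def)

lemma mpoly_to_complex_add: "mpoly_to_complex (p + q) = mpoly_to_complex p + mpoly_to_complex q"
  by (intro poly_mapping_eqI) (simp add: lookup_mpoly_to_complex lookup_add of_rat_add)

lemma mpoly_to_complex_single: "mpoly_to_complex (Poly_Mapping.single m a) = Poly_Mapping.single m (of_rat a)"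
  by (intro poly_mapping_eqI) (simp add: lookup_mpoly_to_complex lookup_single when_def)

lemma mpoly_to_complex_conic_form:
  "mpoly_to_complex (conic_form k a0 a1 a2 b0 b1 c) =
    conic_form k (of_rat a0) (of_rat a1) (of_rat a2) (of_rat b0) (of_rat b1) (of_rat c)"
  by (simp add: conic_form_def mpoly_to_complex_add mpoly_to_complex_single)

lemma mpoly_pderiv_superset:
  assumes "finite S" "Poly_Mapping.keys p \<subseteq> S"
  shows "mpoly_pderiv i p = (\<Sum>m\<in>S. Poly_Mapping.single (m - Poly_Mapping.single i 1)
       (of_nat (Poly_Mapping.lookup m i) * Poly_Mapping.lookup p m))"
  unfolding mpoly_pderiv_def using assms
  by (intro sum.mono_neutral_left) (auto simp: in_keys_iff)

lemma mpoly_pderiv_add: "mpoly_pderiv i (p + q) = mpoly_pderiv i p + mpoly_pderiv i q"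
  using mpoly_pderiv_superset[of "Poly_Mapping.keys p \<union> Poly_Mapping.keys q" "p + q" i]
    mpoly_pderiv_superset[of "Poly_Mapping.keys p \<union> Poly_Mapping.keys q" p i]
    mpoly_pderiv_superset[of "Poly_Mapping.keys p \<union> Poly_Mapping.keys q" q i] keys_add[of p q]
  by (simp add: lookup_add distrib_left single_add sum.distrib)

lemma mpoly_pderiv_single:
  "mpoly_pderiv i (Poly_Mapping.single m a) =
     Poly_Mapping.single (m - Poly_Mapping.single i 1) (of_nat (Poly_Mapping.lookup m i) * a)"
  by (simp add: mpoly_pderiv_def)

section \<open>Smoothness at the complex points\<close>

lemma gradient_at_conic_form:
  fixes a0 a1 a2 b0 b1 c :: rat and x :: "nat \<Rightarrow> complex"
  assumes "k > 0"
  shows "gradient_at x (conic_form k a0 a1 a2 b0 b1 c) 0 =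
      of_nat k * x 0 ^ (k - 1) * (2 * of_rat a0 * x 0 ^ k + of_rat a1 * x 1 ^ k + of_rat b0 * x 2 ^ k)"
    and "gradient_at x (conic_form k a0 a1 a2 b0 b1 c) 1 =
      of_nat k * x 1 ^ (k - 1) * (of_rat a1 * x 0 ^ k + 2 * of_rat a2 * x 1 ^ k + of_rat b1 * x 2 ^ k)"
    and "gradient_at x (conic_form k a0 a1 a2 b0 b1 c) 2 =
      of_nat k * x 2 ^ (k - 1) * (of_rat b0 * x 0 ^ k + of_rat b1 * x 1 ^ k + 2 * of_rat c * x 2 ^ k)"
proof -
  have p: "y ^ (2 * k - Suc 0) = y ^ (k - 1) * y ^ k" for y :: complex
    using assms by (simp add: mult_2 flip: power_add)
  note s = gradient_at_def conic_form_def mpoly_pderiv_add mpoly_pderiv_single mpoly_to_complex_add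
     mpoly_to_complex_single mpoly_eval_add mpoly_eval_0 mon3_minus_single mpoly_eval_single_mon3 lookup_mon3 of_rat_mult
  show "gradient_at x (conic_form k a0 a1 a2 b0 b1 c) 0 =
      of_nat k * x 0 ^ (k - 1) * (2 * of_rat a0 * x 0 ^ k + of_rat a1 * x 1 ^ k + of_rat b0 * x 2 ^ k)"
    by (simp add: s p) (simp add: algebra_simps)
  show "gradient_at x (conic_form k a0 a1 a2 b0 b1 c) 1 =
      of_nat k * x 1 ^ (k - 1) * (of_rat a1 * x 0 ^ k + 2 * of_rat a2 * x 1 ^ k + of_rat b1 * x 2 ^ k)"
    by (simp add: s p) (simp add: algebra_simps)
  show "gradient_at x (conic_form k a0 a1 a2 b0 b1 c) 2 =
      of_nat k * x 2 ^ (k - 1) * (of_rat b0 * x 0 ^ k + of_rat b1 * x 1 ^ k + 2 * of_rat c * x 2 ^ k)"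
    by (simp add: s p) (simp add: algebra_simps)
qed

text \<open>With \<open>X = u\<^sup>k\<close>, \<open>Y = v\<^sup>k\<close>, \<open>Z = w\<^sup>k\<close> the last three hypotheses express that the partial derivatives of
  \<open>Q(u\<^sup>k, v\<^sup>k, w\<^sup>k)\<close> vanish.\<close>

lemma (in smooth_conic) partials_zero_imp_zero:
  assumes conic: "a0 * X\<^sup>2 + a1 * X * Y + a2 * Y\<^sup>2 + b0 * X * Z + b1 * Y * Z + c * Z\<^sup>2 = 0"
    and "X = 0 \<or> 2 * a0 * X + a1 * Y + b0 * Z = 0"
    and "Y = 0 \<or> a1 * X + 2 * a2 * Y + b1 * Z = 0"
    and "Z = 0 \<or> b0 * X + b1 * Y + 2 * c * Z = 0"
  shows "X = 0 \<and> Y = 0 \<and> Z = 0"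
proof -
  \<comment> \<open>The two-variable case, for the restriction of the conic to a side of the
    coordinate triangle.\<close>
  have binary: "u = 0 \<and> v = 0"
    if "p \<noteq> 0" "r \<noteq> 0" "q\<^sup>2 \<noteq> 4 * p * r" "p * u\<^sup>2 + q * u * v + r * v\<^sup>2 = 0"
      "u = 0 \<or> 2 * p * u + q * v = 0" "v = 0 \<or> q * u + 2 * r * v = 0" for p q r u v :: 'a
  proof -
    have "u = 0 \<longleftrightarrow> v = 0" using that by auto
    moreover have "u = 0" if "2 * p * u + q * v = 0" "q * u + 2 * r * v = 0"
    proof -
      have "(4 * p * r - q\<^sup>2) * u = 2 * r * (2 * p * u + q * v) - q * (q * u + 2 * r * v)"
        by (simp add: power2_eq_square algebra_simps)
      then show ?thesis using that \<open>q\<^sup>2 \<noteq> 4 * p * r\<close> by simp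
    qed
    ultimately show ?thesis using that by auto
  qed
  have "X = 0 \<or> Y = 0 \<or> Z = 0"
  proof (rule ccontr)
    assume n: "\<not> ?thesis"
    then have eqs: "2 * a0 * X + a1 * Y + b0 * Z = 0" "a1 * X + 2 * a2 * Y + b1 * Z = 0"
      "b0 * X + b1 * Y + 2 * c * Z = 0" using assms by auto
    define e where "e = 4 * a0 * a2 * c + a1 * b0 * b1 - a0 * b1\<^sup>2 - a2 * b0\<^sup>2 - c * a1\<^sup>2"
    \<comment> \<open>Cramer's rule: the multipliers are cofactors of the Hessian matrix, whose
      determinant is \<open>2 e\<close>.\<close>
    have "2 * (e * X) =
      (4 * a2 * c - b1\<^sup>2) * (2 * a0 * X + a1 * Y + b0 * Z) +
      (b0 * b1 - 2 * a1 * c) * (a1 * X + 2 * a2 * Y + b1 * Z) +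
      (a1 * b1 - 2 * a2 * b0) * (b0 * X + b1 * Y + 2 * c * Z)"
      by (simp add: e_def power2_eq_square algebra_simps)
    then have "e * X = 0" by (simp add: eqs)
    then show False using n det by (simp add: e_def)
  qed
  then show ?thesis
    using binary[of a2 c b1 Y Z] binary[of a0 c b0 X Z] binary[of a0 a2 a1 X Y] vertex edge assms
    by auto
qed

lemma hom_coords_if_in_proj_space: "P \<in> proj_space N \<Longrightarrow> x \<in> P \<Longrightarrow> x \<in> hom_coords N"
  by (auto simp: proj_space_def proportional_def elim!: quotientE)

lemma hom_coords_2_nonzero: "x \<in> hom_coords 2 \<Longrightarrow> x 0 \<noteq> 0 \<or> x 1 \<noteq> 0 \<or> x 2 \<noteq> 0"
  by (auto simp: hom_coords_def le_Suc_eq numeral_2_eq_2)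

lemma smooth_conic_of_rat:
  assumes "smooth_conic a0 a1 a2 b0 b1 c"
  shows "smooth_conic (of_rat a0 :: 'a::field_char_0) (of_rat a1) (of_rat a2) (of_rat b0) (of_rat b1) (of_rat c)"
proof -
  interpret smooth_conic a0 a1 a2 b0 b1 c by fact
  have *: "(of_rat u :: 'a) \<noteq> of_rat v" if "u \<noteq> v" for u v using that by simp
  show ?thesis
    using vertex *[OF edge(1)] *[OF edge(2)] *[OF edge(3)] *[OF det]
    by unfold_locales (simp_all add: of_rat_mult of_rat_power of_rat_add of_rat_diff)
qed

text \<open>For one plane equation, Jacobian rank 1 means a nonzero gradient;
  \<open>partials_zero_imp_zero\<close> at the \<open>k\<close>-th powers of the coordinates
  provides it.\<close>

lemma smooth_of_dimension_conic_form:
  assumes "smooth_conic a0 a1 a2 b0 b1 c" "k > 0"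
  shows "smooth_of_dimension 2 {conic_form k a0 a1 a2 b0 b1 c} 1"
  unfolding smooth_of_dimension_def
proof (intro ballI)
  let ?f = "conic_form k a0 a1 a2 b0 b1 c"
  interpret smooth_conic "of_rat a0 :: complex" "of_rat a1" "of_rat a2" "of_rat b0" "of_rat b1" "of_rat c"
    by (rule smooth_conic_of_rat) fact
  interpret V: vector_space "\<lambda>(c::complex) v (i::nat). c * v i" by (rule vector_space_pointwise)
  fix P x assume P: "P \<in> complex_points 2 {?f}" "x \<in> P"
  then have x: "x \<in> hom_coords 2"
    by (auto simp: complex_points_def proj_zeros_def intro: hom_coords_if_in_proj_space)
  have zero: "mpoly_eval x (mpoly_to_complex ?f) = 0"
    using P by (auto simp: complex_points_def proj_zeros_def)
  have "gradient_at x ?f \<noteq> 0"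
  proof
    assume g: "gradient_at x ?f = 0"
    have "x 0 ^ k = 0 \<and> x 1 ^ k = 0 \<and> x 2 ^ k = 0"
    proof (rule partials_zero_imp_zero)
      show "of_rat a0 * (x 0 ^ k)\<^sup>2 + of_rat a1 * x 0 ^ k * x 1 ^ k + of_rat a2 * (x 1 ^ k)\<^sup>2
        + of_rat b0 * x 0 ^ k * x 2 ^ k + of_rat b1 * x 1 ^ k * x 2 ^ k + of_rat c * (x 2 ^ k)\<^sup>2 = 0"
        using zero by (simp add: mpoly_to_complex_conic_form mpoly_eval_conic_form mult_ac flip: power_mult)
    qed (use gradient_at_conic_form[OF \<open>k > 0\<close>, of x a0 a1 a2 b0 b1 c] g \<open>k > 0\<close> in auto)
    then show False using hom_coords_2_nonzero[OF x] \<open>k > 0\<close> by simp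
  qed
  then have "V.independent {gradient_at x ?f}" by (simp add: V.independent_insert)
  then have "V.dim {gradient_at x ?f} = 1" by (simp add: V.dim_eq_card_independent)
  then show "jacobian_rank {?f} x + 1 = 2" by (simp add: jacobian_rank_def)
qed

text \<open>Setting the coordinate \<open>x\<^sub>1\<^sub>-\<^sub>i\<close> to \<open>1\<close>; the other two become \<open>v\<close> and \<open>w\<close>.\<close>

definition dehom :: "nat \<Rightarrow> 'a::comm_semiring_1 mpoly \<Rightarrow> 'a poly poly" where
  "dehom i g = (\<Sum>m\<in>Poly_Mapping.keys g.
     monom (monom (Poly_Mapping.lookup g m) (Poly_Mapping.lookup m i)) (Poly_Mapping.lookup m 2))"

definition pt :: "'a \<Rightarrow> 'a \<Rightarrow> 'a \<Rightarrow> nat \<Rightarrow> 'a::zero" where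
  "pt u v w = (\<lambda>i. if i = 0 then u else if i = 1 then v else if i = 2 then w else 0)"

lemma pt_simps [simp]: "pt u v w 0 = u" "pt u v w (Suc 0) = v" "pt u v w 2 = w"
  by (simp_all add: pt_def)

lemma pt_in_hom_coords: "u \<noteq> 0 \<or> v \<noteq> 0 \<or> w \<noteq> 0 \<Longrightarrow> pt u v w \<in> hom_coords 2"
proof -
  assume "u \<noteq> 0 \<or> v \<noteq> 0 \<or> w \<noteq> 0"
  then have "pt u v w 0 \<noteq> 0 \<or> pt u v w 1 \<noteq> 0 \<or> pt u v w 2 \<noteq> 0" by simp
  moreover have "0 \<le> (2::nat)" "1 \<le> (2::nat)" "2 \<le> (2::nat)" by auto
  ultimately have "\<exists>i\<le>2. pt u v w i \<noteq> 0" by blast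
  then show ?thesis by (auto simp: hom_coords_def pt_def)
qed

lemma hom_coords_2_eq_pt: "x \<in> hom_coords 2 \<Longrightarrow> x = pt (x 0) (x 1) (x 2)"
  by (auto simp: hom_coords_def pt_def fun_eq_iff)

lemma poly_dehom:
  fixes g :: "'a::comm_ring_1 mpoly"
  assumes "g \<in> mpolys 2"
  shows "poly (poly (dehom 1 g) [:w:]) v = mpoly_eval (pt 1 v w) g"
    and "poly (poly (dehom 0 g) [:w:]) v = mpoly_eval (pt v 1 w) g"
  by (simp_all add: mpoly_eval_mpolys_2[OF assms] dehom_def poly_sum poly_monom poly_const_pow mult_ac)

lemma form_zero_at_multiple:
  fixes g :: "'a::field mpoly"
  assumes "g \<in> forms N d" "s \<noteq> 0"
  shows "mpoly_eval (\<lambda>i. s * x i) g = 0 \<longleftrightarrow> mpoly_eval x g = 0"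
  using assms by (simp add: mpoly_eval_scale)

lemma class_in_proj_zeros:
  fixes f :: "'a::field mpoly"
  assumes "x \<in> hom_coords N" "f \<in> forms N d" "mpoly_eval x f = 0"
  shows "proportional N `` {x} \<in> proj_zeros N {f}"
proof -
  have "mpoly_eval y f = 0" if "(x, y) \<in> proportional N" for y
    using that assms by (auto simp: proportional_def form_zero_at_multiple[OF assms(2)])
  then show ?thesis
    using assms(1) by (auto simp: proj_zeros_def proj_space_def intro: quotientI)
qed

section \<open>Irreducibility of the complex curve, chart by chart\<close>

context smooth_conic_complex
begin

abbreviation "f \<equiv> conic_form k a0 a1 a2 b0 b1 c"

lemma swap: "smooth_conic_complex a2 a1 a0 b1 b0 c k"
  using smooth_conic_swap k by (simp add: smooth_conic_complex_def smooth_conic_complex_axioms_def)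

text \<open>Exchanging the first two coordinates of the conic gives the chart \<open>v = 1\<close>
  an equation of the same shape.\<close>

lemma poly_affine_curve:
  "poly (poly (affine_curve k a0 a1 a2 b0 b1 c) [:w:]) v = mpoly_eval (pt 1 v w) f"
  "poly (poly (affine_curve k a2 a1 a0 b1 b0 c) [:w:]) v = mpoly_eval (pt v 1 w) f"
  by (simp_all add: affine_curve_def poly_trinomial mpoly_eval_conic_form poly_const_pow algebra_simps)

lemma zero_chart_0:
  assumes g: "g \<in> forms 2 d" "\<And>v w. mpoly_eval (pt 1 v w) f = 0 \<Longrightarrow> mpoly_eval (pt 1 v w) g = 0"
    and x: "x \<in> hom_coords 2" "x 0 \<noteq> 0" "mpoly_eval x f = 0"
  shows "mpoly_eval x g = 0"
proof -
  let ?y = "pt 1 (x 1 / x 0) (x 2 / x 0)"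
  have "pt (x 0) (x 1) (x 2) = (\<lambda>i. x 0 * ?y i)" using x(2) by (auto simp: pt_def)
  with hom_coords_2_eq_pt[OF x(1)] have eq: "x = (\<lambda>i. x 0 * ?y i)" by (rule trans)
  have "mpoly_eval x g = 0 \<longleftrightarrow> mpoly_eval ?y g = 0" if "g \<in> forms 2 d" for g d
    using form_zero_at_multiple[OF that x(2), of ?y] by (subst eq)
  then show ?thesis using g x(3) conic_form_in_forms by blast
qed

lemma zero_chart_1:
  assumes g: "g \<in> forms 2 d" "\<And>v w. mpoly_eval (pt v 1 w) f = 0 \<Longrightarrow> mpoly_eval (pt v 1 w) g = 0"
    and x: "x \<in> hom_coords 2" "x 1 \<noteq> 0" "mpoly_eval x f = 0"
  shows "mpoly_eval x g = 0"
proof -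
  let ?y = "pt (x 0 / x 1) 1 (x 2 / x 1)"
  have "pt (x 0) (x 1) (x 2) = (\<lambda>i. x 1 * ?y i)" using x(2) by (auto simp: pt_def)
  with hom_coords_2_eq_pt[OF x(1)] have eq: "x = (\<lambda>i. x 1 * ?y i)" by (rule trans)
  have "mpoly_eval x g = 0 \<longleftrightarrow> mpoly_eval ?y g = 0" if "g \<in> forms 2 d" for g d
    using form_zero_at_multiple[OF that x(2), of ?y] by (subst eq)
  then show ?thesis using g x(3) conic_form_in_forms by blast
qed

text \<open>In the chart \<open>u = 1\<close> the claim is the primality of \<^term>\<open>F\<close>. It carries over to the chart
  \<open>v = 1\<close> since there \<open>u g\<close> vanishes on the curve and \<open>u\<close> does not; the curve avoids the
  remaining point \<open>(0 : 0 : 1)\<close>.\<close>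

lemma form_zero_on_curve:
  assumes g: "g \<in> forms 2 d" "\<And>v w. mpoly_eval (pt 1 v w) f = 0 \<Longrightarrow> mpoly_eval (pt 1 v w) g = 0"
    and x: "x \<in> hom_coords 2" "mpoly_eval x f = 0"
  shows "mpoly_eval x g = 0"
proof -
  interpret S: smooth_conic_complex a2 a1 a0 b1 b0 c k by (rule swap)
  have gm: "g \<in> mpolys 2" using g(1) forms_subset_mpolys by blast
  let ?u = "[:[:0, 1:]:] :: complex poly poly"
  have "v * mpoly_eval (pt v 1 w) g = 0" if "mpoly_eval (pt v 1 w) f = 0" for v w
    using zero_chart_0[OF g, of "pt v 1 w"] that by (cases "v = 0") (auto intro: pt_in_hom_coords)
  then have "(\<forall>v w. poly (poly S.F [:w:]) v = 0 \<longrightarrow> poly (poly ?u [:w:]) v = 0) \<or>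
    (\<forall>v w. poly (poly S.F [:w:]) v = 0 \<longrightarrow> poly (poly (dehom 0 g) [:w:]) v = 0)"
    by (intro S.zero_product_imp_zero_factor) (simp add: poly_affine_curve poly_dehom gm)
  \<comment> \<open>At the point \<open>(1 : 1 : w)\<close> of the curve the coordinate
    \<open>u\<close> is nonzero, which rules out the first alternative.\<close>
  moreover obtain w where "poly (trinomial k (a0 + a1 + a2) (b0 + b1) c) w = 0"
    using trinomial_root_exists k vertex by metis
  then have "poly (poly S.F [:w:]) 1 = 0"
    by (simp add: poly_affine_curve mpoly_eval_conic_form poly_trinomial algebra_simps)
  ultimately have chart_1: "mpoly_eval (pt v 1 w) g = 0" if "mpoly_eval (pt v 1 w) f = 0" for v w
    using that by (auto simp: poly_affine_curve poly_dehom gm)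
  have "x 0 \<noteq> 0 \<or> x 1 \<noteq> 0"
    using hom_coords_2_nonzero[OF x(1)] x(2) k vertex by (auto simp: mpoly_eval_conic_form power_0_left)
  then show ?thesis using zero_chart_0[OF g x(1) _ x(2)] zero_chart_1[OF g(1) chart_1 x(1) _ x(2)] by blast
qed

text \<open>Otherwise there are forms \<open>g\<close>, \<open>h\<close> vanishing on
  \<open>A\<close> and \<open>B\<close> respectively, neither vanishing on the whole curve, although
  \<open>g h\<close> does. Primality in the chart \<open>u = 1\<close> and
  \<open>form_zero_on_curve\<close> exclude this.\<close>

lemma zariski_irreducible_conic_form: "zariski_irreducible 2 (proj_zeros 2 {f})"
proof -
  define X where "X = proj_zeros 2 {f}"
  have class_in_X: "\<exists>P\<in>X. x \<in> P" if "x \<in> hom_coords 2" "mpoly_eval x f = 0" for x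
  proof (intro bexI)
    show "x \<in> proportional 2 `` {x}" using that equiv_class_self[OF equiv_proportional] by blast
    show "proportional 2 `` {x} \<in> X"
      unfolding X_def using that by (intro class_in_proj_zeros[OF _ conic_form_in_forms])
  qed
  have "X \<noteq> {}"
  proof -
    obtain w where "poly (trinomial k (a0 + a1 + a2) (b0 + b1) c) w = 0"
      using trinomial_root_exists k vertex by metis
    then have "mpoly_eval (pt 1 1 w) f = 0"
      by (simp add: mpoly_eval_conic_form poly_trinomial algebra_simps)
    then show ?thesis using class_in_X[of "pt 1 1 w"] pt_in_hom_coords[of 1 1 w] by auto
  qed
  moreover have "X \<subseteq> A \<or> X \<subseteq> B"
    if closed: "zariski_closed 2 A" "zariski_closed 2 B" and sub: "X \<subseteq> A \<union> B" for A B
  proof (rule ccontr)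
    assume neg: "\<not> ?thesis"
    have nonzero: "\<exists>g d x. g \<in> forms 2 d \<and> x \<in> hom_coords 2 \<and> mpoly_eval x f = 0 \<and> mpoly_eval x g \<noteq> 0
        \<and> (\<forall>P\<in>A. \<forall>x\<in>P. mpoly_eval x g = 0)" if "zariski_closed 2 A" "\<not> X \<subseteq> A" for A
    proof -
      obtain G where G: "G \<subseteq> (\<Union>d. forms 2 d)" "A = proj_zeros 2 G"
        using \<open>zariski_closed 2 A\<close> by (auto simp: zariski_closed_def)
      obtain P where P: "P \<in> X" "P \<notin> A" using \<open>\<not> X \<subseteq> A\<close> by blast
      then obtain x g where "x \<in> P" "g \<in> G" "mpoly_eval x g \<noteq> 0"
        using G(2) by (auto simp: X_def proj_zeros_def)
      moreover have "x \<in> hom_coords 2" "mpoly_eval x f = 0"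
        using P(1) \<open>x \<in> P\<close> hom_coords_if_in_proj_space by (auto simp: X_def proj_zeros_def)
      moreover obtain d where "g \<in> forms 2 d" using G(1) \<open>g \<in> G\<close> by blast
      moreover have "\<forall>P\<in>A. \<forall>x\<in>P. mpoly_eval x g = 0"
        using G(2) \<open>g \<in> G\<close> by (auto simp: proj_zeros_def)
      ultimately show ?thesis by blast
    qed
    obtain g d x where g: "g \<in> forms 2 d" "x \<in> hom_coords 2" "mpoly_eval x f = 0" "mpoly_eval x g \<noteq> 0"
      "\<And>P x. P \<in> A \<Longrightarrow> x \<in> P \<Longrightarrow> mpoly_eval x g = 0"
      using nonzero[OF closed(1)] neg by blast
    obtain h e y where h: "h \<in> forms 2 e" "y \<in> hom_coords 2" "mpoly_eval y f = 0" "mpoly_eval y h \<noteq> 0"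
      "\<And>P x. P \<in> B \<Longrightarrow> x \<in> P \<Longrightarrow> mpoly_eval x h = 0"
      using nonzero[OF closed(2)] neg by blast
    have gh: "g \<in> mpolys 2" "h \<in> mpolys 2" using g(1) h(1) forms_subset_mpolys by blast+
    have "mpoly_eval (pt 1 v w) g * mpoly_eval (pt 1 v w) h = 0" if "mpoly_eval (pt 1 v w) f = 0" for v w
    proof -
      obtain P where "P \<in> X" "pt 1 v w \<in> P"
        using class_in_X[OF pt_in_hom_coords \<open>mpoly_eval (pt 1 v w) f = 0\<close>] by auto
      moreover from this have "P \<in> A \<or> P \<in> B" using sub by blast
      ultimately show ?thesis using g(5)[of P] h(5)[of P] by auto
    qed
    then have "(\<forall>v w. poly (poly F [:w:]) v = 0 \<longrightarrow> poly (poly (dehom 1 g) [:w:]) v = 0) \<or>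
      (\<forall>v w. poly (poly F [:w:]) v = 0 \<longrightarrow> poly (poly (dehom 1 h) [:w:]) v = 0)"
      by (intro zero_product_imp_zero_factor) (simp only: poly_affine_curve poly_dehom gh)
    then have "(\<forall>v w. mpoly_eval (pt 1 v w) f = 0 \<longrightarrow> mpoly_eval (pt 1 v w) g = 0) \<or>
      (\<forall>v w. mpoly_eval (pt 1 v w) f = 0 \<longrightarrow> mpoly_eval (pt 1 v w) h = 0)"
      by (simp only: poly_affine_curve poly_dehom gh)
    then show False using form_zero_on_curve g(1-4) h(1-4) by blast
  qed
  ultimately show ?thesis unfolding zariski_irreducible_def X_def by blast
qed

end

lemma geometrically_irreducible_conic_form:
  assumes "smooth_conic a0 a1 a2 b0 b1 c" "k > 0"
  shows "geometrically_irreducible 2 {conic_form k a0 a1 a2 b0 b1 c}"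
proof -
  interpret smooth_conic_complex "of_rat a0" "of_rat a1" "of_rat a2" "of_rat b0" "of_rat b1" "of_rat c" k
    using smooth_conic_of_rat[OF assms(1)] assms(2)
    by (simp add: smooth_conic_complex_def smooth_conic_complex_axioms_def)
  show ?thesis
    using zariski_irreducible_conic_form
    by (simp add: geometrically_irreducible_def complex_points_def mpoly_to_complex_conic_form)
qed


section \<open>The Hilbert polynomial of a plane curve\<close>

abbreviation exp_deg :: "nat \<Rightarrow> monom_exp \<Rightarrow> nat" where
  "exp_deg N m \<equiv> (\<Sum>i\<le>N. Poly_Mapping.lookup m i)"

definition exps :: "nat \<Rightarrow> nat \<Rightarrow> monom_exp set" where
  "exps N d = {m. Poly_Mapping.keys m \<subseteq> {..N} \<and> exp_deg N m = d}"

lemma forms_eq: "forms N d = {p. Poly_Mapping.keys p \<subseteq> exps N d}"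
  by (auto simp: forms_def mpolys_def exps_def)

lemma exps_2_eq: "exps 2 d = (\<lambda>(i, j). mon3 i j (d - i - j)) ` (SIGMA i:{..d}. {..d - i})"
proof (intro equalityI subsetI)
  fix m assume m: "m \<in> exps 2 d"
  then have d: "Poly_Mapping.lookup m 0 + Poly_Mapping.lookup m 1 + Poly_Mapping.lookup m 2 = d"
    by (simp add: exps_def atMost_2)
  have "Poly_Mapping.lookup m n = 0" if "n > 2" for n
    using m that in_keys_iff[of n m] by (force simp: exps_def)
  then have "m = mon3 (Poly_Mapping.lookup m 0) (Poly_Mapping.lookup m 1) (Poly_Mapping.lookup m 2)"
    by (intro poly_mapping_eqI) (auto simp: lookup_mon3)
  also have "Poly_Mapping.lookup m 2 = d - Poly_Mapping.lookup m 0 - Poly_Mapping.lookup m 1" using d by simp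
  finally show "m \<in> (\<lambda>(i, j). mon3 i j (d - i - j)) ` (SIGMA i:{..d}. {..d - i})"
    using d by (intro image_eqI[of _ _ "(Poly_Mapping.lookup m 0, Poly_Mapping.lookup m 1)"]) auto
next
  fix m assume "m \<in> (\<lambda>(i, j). mon3 i j (d - i - j)) ` (SIGMA i:{..d}. {..d - i})"
  then obtain i j where "i \<le> d" "j \<le> d - i" and m: "m = mon3 i j (d - i - j)" by auto
  then have ij: "i + j \<le> d" by simp
  have "Poly_Mapping.keys m \<subseteq> {..2}" by (auto simp: m in_keys_iff lookup_mon3 split: if_splits)
  then show "m \<in> exps 2 d" using ij by (simp add: exps_def m atMost_2 lookup_mon3)
qed

lemma finite_exps_2: "finite (exps 2 d)"
  by (simp add: exps_2_eq)

lemma card_exps_2: "2 * card (exps 2 d) = (d + 1) * (d + 2)"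
proof -
  have "inj_on (\<lambda>(i, j). mon3 i j (d - i - j)) (SIGMA i:{..d}. {..d - i})"
  proof (rule inj_onI, clarify)
    fix i j i' j' assume eq: "mon3 i j (d - i - j) = mon3 i' j' (d - i' - j')"
    show "i = i' \<and> j = j'"
      using arg_cong[OF eq, of "\<lambda>m. Poly_Mapping.lookup m 0"] arg_cong[OF eq, of "\<lambda>m. Poly_Mapping.lookup m 1"]
      by (simp add: lookup_mon3)
  qed
  then have "card (exps 2 d) = (\<Sum>i\<le>d. Suc (d - i))"
    by (simp add: exps_2_eq card_image)
  also have "\<dots> = (\<Sum>i\<le>d. Suc i)" by (rule sum.nat_diff_reindex[of _ "Suc d", simplified lessThan_Suc_atMost, simplified])
  also have "2 * \<dots> = (d + 1) * (d + 2)" by (induction d) auto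
  finally show ?thesis .
qed

lemma poly_mapping_eq_sum_single: "p = (\<Sum>m\<in>Poly_Mapping.keys p. Poly_Mapping.single m (Poly_Mapping.lookup p m))"
proof (rule poly_mapping_eqI)
  fix n
  have "(\<Sum>m\<in>Poly_Mapping.keys p. Poly_Mapping.lookup (Poly_Mapping.single m (Poly_Mapping.lookup p m)) n) =
    (\<Sum>m\<in>Poly_Mapping.keys p. if m = n then Poly_Mapping.lookup p n else 0)"
    by (intro sum.cong) (auto simp: lookup_single when_def)
  then show "Poly_Mapping.lookup p n =
      Poly_Mapping.lookup (\<Sum>m\<in>Poly_Mapping.keys p. Poly_Mapping.single m (Poly_Mapping.lookup p m)) n"
    by (simp add: lookup_sum in_keys_iff)
qed

text \<open>Multiplication by \<open>f\<close> is injective, so the multiples of the monomials of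
  degree \<open>d\<close> form a basis. The case \<open>f = 1\<close> gives the dimension of the
  space of forms itself.\<close>

lemma dim_multiples_of_forms:
  fixes f :: "rat mpoly"
  assumes "f \<noteq> 0" "finite (exps N d)"
  shows "vector_space.dim mpoly_scale ((*) f ` forms N d) = card (exps N d)"
proof -
  interpret vector_space "mpoly_scale :: rat \<Rightarrow> _" by (rule vector_space_mpoly_scale)
  define b where "b m = f * Poly_Mapping.single m 1" for m
  have single_1: "(Poly_Mapping.single m (1::rat) = Poly_Mapping.single m' 1) = (m = m')" for m m' :: monom_exp
    by (metis lookup_single_eq lookup_single_not_eq zero_neq_one)
  have inj: "inj_on b (exps N d)"
    using assms(1) by (auto simp: inj_on_def b_def single_1)
  have scale: "mpoly_scale s (b m) = f * Poly_Mapping.single m s" for s m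
    by (simp add: mpoly_scale_def b_def mult.left_commute mult_single)
  show ?thesis
  proof (rule dim_unique)
    show "b ` exps N d \<subseteq> (*) f ` forms N d"
      by (auto simp: b_def forms_eq)
    show "(*) f ` forms N d \<subseteq> span (b ` exps N d)"
    proof clarify
      fix p :: "rat mpoly" assume p: "p \<in> forms N d"
      have "f * p = (\<Sum>m\<in>Poly_Mapping.keys p. mpoly_scale (Poly_Mapping.lookup p m) (b m))"
        by (subst poly_mapping_eq_sum_single[of p]) (simp add: sum_distrib_left scale)
      also have "\<dots> \<in> span (b ` exps N d)"
        using p by (intro span_sum span_scale span_base imageI) (auto simp: forms_eq)
      finally show "f * p \<in> span (b ` exps N d)" .
    qed
    show "independent (b ` exps N d)"
    proof (rule independent_if_scalars_zero)
      show "finite (b ` exps N d)" using assms by simp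
      fix u x assume sum0: "(\<Sum>x\<in>b ` exps N d. mpoly_scale (u x) x) = 0" and "x \<in> b ` exps N d"
      then obtain n where n: "n \<in> exps N d" "x = b n" by blast
      have "0 = f * (\<Sum>m\<in>exps N d. Poly_Mapping.single m (u (b m)))"
        using sum0 inj by (simp add: sum.reindex scale sum_distrib_left)
      then have "0 = Poly_Mapping.lookup (\<Sum>m\<in>exps N d. Poly_Mapping.single m (u (b m))) n"
        using assms(1) by simp
      also have "\<dots> = (\<Sum>m\<in>exps N d. if m = n then u (b n) else 0)"
        unfolding lookup_sum by (intro sum.cong) (auto simp: lookup_single when_def)
      also have "\<dots> = u x" using n assms(2) by simp
      finally show "u x = 0" by simp
    qed
    show "card (b ` exps N d) = card (exps N d)" using inj by (rule card_image)
  qed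
qed

text \<open>The predicate \<open>P\<close> on degrees lets the same statement serve for a
  homogeneous factor and for one avoiding a given degree.\<close>

lemma keys_mult_exps:
  fixes p q :: "'a::comm_semiring_1 mpoly"
  assumes "q \<in> forms N d" "\<And>m. m \<in> Poly_Mapping.keys p \<Longrightarrow> Poly_Mapping.keys m \<subseteq> {..N} \<and> P (exp_deg N m)"
    and "n \<in> Poly_Mapping.keys (p * q)"
  shows "Poly_Mapping.keys n \<subseteq> {..N} \<and> (\<exists>e. P e \<and> exp_deg N n = e + d)"
proof -
  obtain a b where ab: "a \<in> Poly_Mapping.keys p" "b \<in> Poly_Mapping.keys q" "n = a + b"
    using keys_mult[of p q] assms(3) by blast
  then have "Poly_Mapping.keys b \<subseteq> {..N}" "exp_deg N b = d"
    using assms(1) by (auto simp: forms_eq exps_def)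
  then show ?thesis
    using assms(2)[OF ab(1)] keys_add[of a b] unfolding ab(3)
    by (auto simp: lookup_add sum.distrib)
qed

lemma ideal_of_singleton: "ideal_of N {f} = (\<lambda>q. q * f) ` mpolys N"
  unfolding ideal_of_def by (auto intro: exI[of _ "\<lambda>_. _"])

text \<open>Split \<open>q\<close> in \<open>p = q f\<close> into its part of degree
  \<open>t - d\<close> and the rest. The rest times \<open>f\<close> has no term of degree
  \<open>t\<close>, yet it is a difference of two forms of degree \<open>t\<close>, so it is
  zero.\<close>

lemma ideal_of_form_inter_forms:
  fixes f :: "rat mpoly"
  assumes f: "f \<in> forms N d" and "d \<le> t"
  shows "ideal_of N {f} \<inter> forms N t = (*) f ` forms N (t - d)"
proof (intro equalityI subsetI)
  fix p assume "p \<in> (*) f ` forms N (t - d)"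
  then obtain q where q: "q \<in> forms N (t - d)" "p = q * f" by (auto simp: mult.commute)
  then have "n \<in> exps N t" if "n \<in> Poly_Mapping.keys p" for n
    using keys_mult_exps[OF f, of q "\<lambda>e. e = t - d" n] that \<open>d \<le> t\<close> by (auto simp: forms_eq exps_def)
  then show "p \<in> ideal_of N {f} \<inter> forms N t"
    using q subsetD[OF forms_subset_mpolys q(1)] by (auto simp: ideal_of_singleton forms_eq[of N t])
next
  fix p assume "p \<in> ideal_of N {f} \<inter> forms N t"
  then obtain q where q: "q \<in> mpolys N" "p = q * f" and p: "p \<in> forms N t"
    by (auto simp: ideal_of_singleton)
  define part where "part S = (\<Sum>m\<in>Poly_Mapping.keys q \<inter> S. Poly_Mapping.single m (Poly_Mapping.lookup q m))"
    for S
  let ?E = "{m. exp_deg N m = t - d}"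
  have keys_part: "Poly_Mapping.keys (part S) \<subseteq> Poly_Mapping.keys q \<inter> S" for S
    using keys_sum[of "\<lambda>m. Poly_Mapping.single m (Poly_Mapping.lookup q m)" "Poly_Mapping.keys q \<inter> S"]
    unfolding part_def by (auto split: if_splits)
  have "q = part ?E + part (- ?E)"
    unfolding part_def
    by (subst sum.union_disjoint[symmetric])
       (auto simp: poly_mapping_eq_sum_single[symmetric] simp flip: Int_Un_distrib)
  then have split: "p - part ?E * f = part (- ?E) * f" by (simp add: q(2) algebra_simps)
  have E: "part ?E \<in> forms N (t - d)"
    using keys_part[of ?E] q(1) by (auto simp: forms_eq exps_def mpolys_def)
  have "n \<notin> Poly_Mapping.keys (part (- ?E) * f)" for n
  proof
    assume n: "n \<in> Poly_Mapping.keys (part (- ?E) * f)"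
    have "Poly_Mapping.keys m \<subseteq> {..N} \<and> exp_deg N m \<noteq> t - d"
      if "m \<in> Poly_Mapping.keys (part (- ?E))" for m
      using keys_part[of "- ?E"] q(1) that by (auto simp: mpolys_def)
    then have "\<exists>e. e \<noteq> t - d \<and> exp_deg N n = e + d"
      using keys_mult_exps[OF f, where P = "\<lambda>e. e \<noteq> t - d"] n by blast
    then have "exp_deg N n \<noteq> t" by auto
    moreover have "n \<in> Poly_Mapping.keys p \<or> n \<in> Poly_Mapping.keys (part ?E * f)"
      using n keys_diff[of p "part ?E * f"] by (auto simp: split)
    moreover have "exp_deg N n = t" if "n \<in> Poly_Mapping.keys (part ?E * f)"
      using keys_mult_exps[OF f _ that, of "\<lambda>e. e = t - d"] E \<open>d \<le> t\<close> by (auto simp: forms_eq exps_def)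
    ultimately show False using p by (auto simp: forms_eq exps_def)
  qed
  then have "part (- ?E) * f = 0" by (metis equals0I keys_eq_empty)
  then have "p - part ?E * f = 0" by (simp only: split)
  then have "p = f * part ?E" by (simp add: mult.commute)
  then show "p \<in> (*) f ` forms N (t - d)" using E by blast
qed

text \<open>The linear polynomial \<open>d t + d (3 - d) / 2\<close>; it gives the genus
  \<open>(d - 1) (d - 2) / 2\<close>.\<close>

definition plane_curve_poly :: "nat \<Rightarrow> rat poly" where
  "plane_curve_poly d = [: of_nat d * (3 - of_nat d) / 2, of_nat d :]"

text \<open>Counting monomials, the Hilbert function at \<open>t \<ge> d\<close> is
  \<open>(t + 2 choose 2) - (t - d + 2 choose 2)\<close>.\<close>

lemma hilbert_poly_plane_curve:
  assumes "f \<in> forms 2 d" "f \<noteq> 0"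
  shows "is_hilbert_poly 2 {f} (plane_curve_poly d)"
  unfolding is_hilbert_poly_def
proof (rule eventually_sequentiallyI)
  fix t assume "d \<le> t"
  have R: "vector_space.dim mpoly_scale (forms 2 t :: rat mpoly set) = card (exps 2 t)"
    using dim_multiples_of_forms[of 1 2 t] finite_exps_2 by simp
  have I: "vector_space.dim mpoly_scale (ideal_of 2 {f} \<inter> forms 2 t) = card (exps 2 (t - d))"
    using dim_multiples_of_forms[OF assms(2)] finite_exps_2 ideal_of_form_inter_forms[OF assms(1) \<open>d \<le> t\<close>] by simp
  have c: "of_nat (card (exps 2 s)) = (of_nat s + 1) * (of_nat s + 2) / (2::rat)" for s
    using arg_cong[OF card_exps_2[of s], of "of_nat :: nat \<Rightarrow> rat"] by (simp add: field_simps)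
  obtain s where s: "t = d + s" using \<open>d \<le> t\<close> le_Suc_ex by blast
  have "2 * card (exps 2 s) \<le> 2 * card (exps 2 t)" unfolding card_exps_2 s by (intro mult_mono) auto
  then have "of_nat (hilbert_function 2 {f} t) = of_nat (card (exps 2 t)) - (of_nat (card (exps 2 s)) :: rat)"
    by (simp add: hilbert_function_def R I) (simp add: s of_nat_diff)
  then show "of_nat (hilbert_function 2 {f} t) = poly (plane_curve_poly d) (of_nat t)"
    by (simp add: c plane_curve_poly_def s field_simps)
qed

lemma smooth_projective_curve_conic_form:
  assumes Q: "smooth_conic a0 a1 a2 b0 b1 c" and k: "k > 0"
  shows "smooth_projective_curve 2 {conic_form k a0 a1 a2 b0 b1 c}"
    and "has_genus 2 {conic_form k a0 a1 a2 b0 b1 c} ((2 * k - 1) * (k - 1))"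
proof -
  let ?f = "conic_form k a0 a1 a2 b0 b1 c"
  have "mpoly_eval (pt 1 0 0) ?f \<noteq> 0"
    using Q k by (simp add: mpoly_eval_conic_form power_0_left smooth_conic_def)
  then have "?f \<noteq> 0" by (auto simp: mpoly_eval_0)
  then have hp: "is_hilbert_poly 2 {?f} (plane_curve_poly (2 * k))"
    by (intro hilbert_poly_plane_curve conic_form_in_forms)
  have "plane_curve_poly (2 * k) \<noteq> 0 \<and> Polynomial.degree (plane_curve_poly (2 * k)) = 1"
    using k by (simp add: plane_curve_poly_def)
  then have "has_dimension 2 {?f} 1" using hp by (auto simp: has_dimension_def)
  then show "smooth_projective_curve 2 {?f}"
    using smooth_of_dimension_conic_form[OF Q k] geometrically_irreducible_conic_form[OF Q k]
      conic_form_in_forms[of k a0 a1 a2 b0 b1 c]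
    by (auto simp: smooth_projective_curve_def)
  obtain j where j: "k = Suc j" using k gr0_implies_Suc by blast
  have "of_nat ((2 * k - 1) * (k - 1)) = 1 - poly (plane_curve_poly (2 * k)) 0"
    by (simp add: plane_curve_poly_def j field_simps)
  then show "has_genus 2 {?f} ((2 * k - 1) * (k - 1))" using hp by (auto simp: has_genus_def)
qed


section \<open>The pencil of quadratic forms\<close>

text \<open>The pencil data: \<open>q\<^sub>i = p\<^sub>i s\<^sup>2 + e\<^sub>i s t + t\<^sup>2\<close> for \<open>i = 1, 2, 3\<close> satisfy
  \<open>L\<^sub>1(q) = \<Delta> s\<^sup>2\<close>, \<open>L\<^sub>2(q) = \<Delta> s t\<close>, \<open>L\<^sub>3(q) = \<Delta> t\<^sup>2\<close> with the linear forms \<open>L\<^sub>i\<close> given by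
  cofactors, so that \<open>L\<^sub>1 L\<^sub>3 - L\<^sub>2\<^sup>2\<close> vanishes at \<open>(q\<^sub>1, q\<^sub>2, q\<^sub>3)\<close>.\<close>

locale quadratic_pencil =
  fixes p1 p2 p3 e1 e2 e3 :: "'a::field_char_0"
begin

definition "\<Delta> = p1 * (e2 - e3) + p2 * (e3 - e1) + p3 * (e1 - e2)"

text \<open>The coefficients \<open>l\<close>, \<open>m\<close>, \<open>n\<close> of
  \<open>L1\<close>, \<open>L2\<close>, \<open>L3\<close> are the cofactors of the matrix with rows
  \<open>(p_i, e_i, 1)\<close>, whose determinant is \<open>\<Delta>\<close>.\<close>

definition "l1 = e2 - e3"
definition "l2 = e3 - e1"
definition "l3 = e1 - e2"
definition "m1 = p3 - p2"
definition "m2 = p1 - p3"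
definition "m3 = p2 - p1"
definition "n1 = p2 * e3 - p3 * e2"
definition "n2 = p3 * e1 - p1 * e3"
definition "n3 = p1 * e2 - p2 * e1"

lemmas defs = \<Delta>_def l1_def l2_def l3_def m1_def m2_def m3_def n1_def n2_def n3_def

text \<open>Coefficients of the conic \<open>L1 L3 - L2^2\<close>.\<close>

definition "c11 = l1 * n1 - m1\<^sup>2"
definition "c22 = l2 * n2 - m2\<^sup>2"
definition "c33 = l3 * n3 - m3\<^sup>2"
definition "c12 = l1 * n2 + l2 * n1 - 2 * m1 * m2"
definition "c13 = l1 * n3 + l3 * n1 - 2 * m1 * m3"
definition "c23 = l2 * n3 + l3 * n2 - 2 * m2 * m3"

lemmas cdefs = c11_def c22_def c33_def c12_def c13_def c23_def

lemma cofactor_relations: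
  defines "q1 s t \<equiv> p1 * s\<^sup>2 + e1 * s * t + t\<^sup>2" and "q2 s t \<equiv> p2 * s\<^sup>2 + e2 * s * t + t\<^sup>2"
    and "q3 s t \<equiv> p3 * s\<^sup>2 + e3 * s * t + t\<^sup>2"
  shows "m1 * q1 s t + m2 * q2 s t + m3 * q3 s t = \<Delta> * s * t"
    and "n1 * q1 s t + n2 * q2 s t + n3 * q3 s t = \<Delta> * t\<^sup>2"
    and "c11 * (q1 s t)\<^sup>2 + c12 * (q1 s t * q2 s t) + c22 * (q2 s t)\<^sup>2 + c13 * (q1 s t * q3 s t)
      + c23 * (q2 s t * q3 s t) + c33 * (q3 s t)\<^sup>2 = 0"
proof -
  show m: "m1 * q1 s t + m2 * q2 s t + m3 * q3 s t = \<Delta> * s * t"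
    unfolding defs q1_def q2_def q3_def by algebra
  show n: "n1 * q1 s t + n2 * q2 s t + n3 * q3 s t = \<Delta> * t\<^sup>2"
    unfolding defs q1_def q2_def q3_def by algebra
  have l: "l1 * q1 s t + l2 * q2 s t + l3 * q3 s t = \<Delta> * s\<^sup>2"
    unfolding defs q1_def q2_def q3_def by algebra
  have "c11 * x\<^sup>2 + c12 * (x * y) + c22 * y\<^sup>2 + c13 * (x * z) + c23 * (y * z) + c33 * z\<^sup>2 =
    (l1 * x + l2 * y + l3 * z) * (n1 * x + n2 * y + n3 * z) - (m1 * x + m2 * y + m3 * z)\<^sup>2" for x y z
    unfolding cdefs by algebra
  then show "c11 * (q1 s t)\<^sup>2 + c12 * (q1 s t * q2 s t) + c22 * (q2 s t)\<^sup>2 + c13 * (q1 s t * q3 s t)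
      + c23 * (q2 s t * q3 s t) + c33 * (q3 s t)\<^sup>2 = 0"
    by (simp only: l m n) (simp add: power2_eq_square)
qed

text \<open>For nonzero \<open>\<Delta>\<close> the conic is parametrized by
  \<open>(q1 : q2 : q3)\<close>, so it meets a coordinate line at the roots of the corresponding
  \<open>q_i\<close>; the discriminants agree up to \<open>\<Delta>^2\<close>.\<close>

lemma edge_discriminants:
  "c12\<^sup>2 - 4 * c11 * c22 = \<Delta>\<^sup>2 * (e3\<^sup>2 - 4 * p3)"
  "c13\<^sup>2 - 4 * c11 * c33 = \<Delta>\<^sup>2 * (e2\<^sup>2 - 4 * p2)"
  "c23\<^sup>2 - 4 * c22 * c33 = \<Delta>\<^sup>2 * (e1\<^sup>2 - 4 * p1)"
  unfolding cdefs defs by algebra+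

text \<open>The conic arises from \<open>X Z - Y^2\<close>, for which this expression is 1, by
  substituting the cofactor matrix, of determinant \<open>\<Delta>^2\<close>.\<close>

lemma conic_determinant:
  "4 * c11 * c22 * c33 + c12 * c13 * c23 - c11 * c23\<^sup>2 - c22 * c13\<^sup>2 - c33 * c12\<^sup>2 = \<Delta> ^ 4"
proof -
  have "l1 * (m2 * n3 - m3 * n2) - l2 * (m1 * n3 - m3 * n1) + l3 * (m1 * n2 - m2 * n1) = \<Delta>\<^sup>2"
    unfolding defs by algebra
  moreover have "4 * c11 * c22 * c33 + c12 * c13 * c23 - c11 * c23\<^sup>2 - c22 * c13\<^sup>2 - c33 * c12\<^sup>2 =
    (l1 * (m2 * n3 - m3 * n2) - l2 * (m1 * n3 - m3 * n1) + l3 * (m1 * n2 - m2 * n1))\<^sup>2"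
    unfolding cdefs by algebra
  ultimately show ?thesis by simp
qed

end

text \<open>Up to sign the resultant of \<open>(a s + t) (b s + t)\<close> and
  \<open>(c s + t) (d s + t)\<close>. The coefficients \<open>c11\<close>, \<open>c22\<close>,
  \<open>c33\<close> have this shape, so they are nonzero when the forms share no root.\<close>

lemma resultant_split:
  fixes a b c d :: "'a::comm_ring_1"
  shows "((a + b) - (c + d)) * ((a * b) * (c + d) - (c * d) * (a + b)) - (c * d - a * b)\<^sup>2 =
    - ((a - c) * (a - d) * (b - c) * (b - d))"
  by (simp add: power2_eq_square algebra_simps)

text \<open>The ordering of the \<open>a i\<close> ensures \<open>\<Delta> < 0\<close>.\<close>

lemma smooth_conic_pencil:
  fixes a :: "nat \<Rightarrow> 'a::linordered_field"
  assumes "a 0 < a 1" "a 1 < a 2" "a 2 < a 3" "a 3 < a 4" "a 4 < a 5"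
  defines "p1 \<equiv> a 0 * a 1" and "p2 \<equiv> a 2 * a 3" and "p3 \<equiv> a 4 * a 5"
    and "e1 \<equiv> a 0 + a 1" and "e2 \<equiv> a 2 + a 3" and "e3 \<equiv> a 4 + a 5"
  shows "quadratic_pencil.\<Delta> p1 p2 p3 e1 e2 e3 \<noteq> 0"
    and "smooth_conic (quadratic_pencil.c11 p2 p3 e2 e3) (quadratic_pencil.c12 p1 p2 p3 e1 e2 e3)
      (quadratic_pencil.c22 p1 p3 e1 e3) (quadratic_pencil.c13 p1 p2 p3 e1 e2 e3)
      (quadratic_pencil.c23 p1 p2 p3 e1 e2 e3) (quadratic_pencil.c33 p1 p2 e1 e2)"
proof -
  interpret quadratic_pencil p1 p2 p3 e1 e2 e3 .
  \<comment> \<open>In this rearrangement every factor is a larger \<open>a i\<close> minus a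
    smaller one.\<close>
  have "- \<Delta> = (a 3 - a 0) * (a 3 - a 1) * (a 5 - a 2)
      + (a 4 - a 3) * ((a 5 - a 0) * (a 2 - a 1) + (a 3 - a 0) * (a 5 - a 2))"
    unfolding defs unfolding p1_def p2_def p3_def e1_def e2_def e3_def by algebra
  also have "\<dots> > 0"
    using assms(1-5) by (intro add_pos_pos mult_pos_pos) auto
  finally show \<Delta>: "\<Delta> \<noteq> 0" by simp
  have "c11 \<noteq> 0"
    using resultant_split[of "a 2" "a 3" "a 4" "a 5"] assms(1-5)
    unfolding cdefs unfolding defs unfolding p2_def p3_def e2_def e3_def by auto
  moreover have "c22 \<noteq> 0"
    using resultant_split[of "a 4" "a 5" "a 0" "a 1"] assms(1-5)
    unfolding cdefs unfolding defs unfolding p1_def p3_def e1_def e3_def by auto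
  moreover have "c33 \<noteq> 0"
    using resultant_split[of "a 0" "a 1" "a 2" "a 3"] assms(1-5)
    unfolding cdefs unfolding defs unfolding p1_def p2_def e1_def e2_def by auto
  moreover have "(b + d)\<^sup>2 - 4 * (b * d) = (b - d)\<^sup>2" for b d :: 'a by algebra
  then have "e1\<^sup>2 - 4 * p1 \<noteq> 0" "e2\<^sup>2 - 4 * p2 \<noteq> 0" "e3\<^sup>2 - 4 * p3 \<noteq> 0"
    using assms(1-5) by (simp_all add: p1_def p2_def p3_def e1_def e2_def e3_def)
  then have "c12\<^sup>2 - 4 * c11 * c22 \<noteq> 0" "c13\<^sup>2 - 4 * c11 * c33 \<noteq> 0" "c23\<^sup>2 - 4 * c22 * c33 \<noteq> 0"
    using \<Delta> by (simp_all only: edge_discriminants) simp_all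
  moreover have "4 * c11 * c22 * c33 + c12 * c13 * c23 - c11 * c23\<^sup>2 - c22 * c13\<^sup>2 - c33 * c12\<^sup>2 \<noteq> 0"
    using \<Delta> by (simp only: conic_determinant) simp
  ultimately show "smooth_conic c11 c12 c22 c13 c23 c33" by unfold_locales auto
qed

lemma six_smallest:
  fixes T :: "nat set"
  assumes "finite T" "card T \<ge> 6"
  obtains a :: "nat \<Rightarrow> nat" where "\<And>i. i < 6 \<Longrightarrow> a i \<in> T" "\<And>i j. i < j \<Longrightarrow> j < 6 \<Longrightarrow> a i < a j"
proof
  let ?l = "sorted_list_of_set T"
  show "?l ! i \<in> T" if "i < 6" for i
    using that assms nth_mem[of i ?l] by simp
  show "?l ! i < ?l ! j" if "i < j" "j < 6" for i j
    using that assms sorted_wrt_nth_less[OF strict_sorted_list_of_set, of i j T] by simp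
qed

section \<open>From Diophantine sets to rational points\<close>

text \<open>Six elements are spent on the curve and the others inject into its rational points.
  \<open>C\<close> serves all plane curves of the given genus, hence is independent of
  \<open>n\<close> and \<open>T\<close>.\<close>

lemma card_le_if_property_D:
  assumes C: "\<And>F. smooth_projective_curve 2 F \<Longrightarrow> has_genus 2 F ((2 * k - 1) * (k - 1)) \<Longrightarrow>
      finite (rational_points 2 F) \<and> card (rational_points 2 F) \<le> C"
    and k: "k > 0" and n: "n \<noteq> 0"
    and T: "finite T" "property_D k n T"
  shows "card T \<le> C + 6"
proof (cases "card T \<ge> 6")
  case True
  obtain a :: "nat \<Rightarrow> nat" where a: "\<And>i. i < 6 \<Longrightarrow> a i \<in> T" and a_less: "\<And>i j. i < j \<Longrightarrow> j < 6 \<Longrightarrow> a i < a j"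
    using six_smallest[OF T(1) True] by metis
  define r :: "nat \<Rightarrow> rat" where "r i = of_nat (a i)" for i
  define p1 p2 p3 where "p1 = r 0 * r 1" "p2 = r 2 * r 3" "p3 = r 4 * r 5"
  note p_def = this
  define e1 e2 e3 where "e1 = r 0 + r 1" "e2 = r 2 + r 3" "e3 = r 4 + r 5"
  note e_def = this
  interpret quadratic_pencil p1 p2 p3 e1 e2 e3 .
  have r_less: "r 0 < r 1" "r 1 < r 2" "r 2 < r 3" "r 3 < r 4" "r 4 < r 5"
    using a_less by (auto simp: r_def)
  have \<Delta>: "\<Delta> \<noteq> 0" and conic: "smooth_conic c11 c12 c22 c13 c23 c33"
    using smooth_conic_pencil[OF r_less] unfolding p_def e_def by auto
  define f where "f = conic_form k c11 c12 c22 c13 c23 c33"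
  have fin: "finite (rational_points 2 {f})" and card: "card (rational_points 2 {f}) \<le> C"
    using C smooth_projective_curve_conic_form[OF conic k] by (auto simp: f_def)
  define S where "S = T - a ` {..<6}"
  have "\<exists>y>0. int (a i) * int b + n = int y ^ k" if "b \<in> S" "i < 6" for b i
    using T(2) a[OF that(2)] that unfolding property_D_def is_kth_power_def S_def by (metis DiffD1 DiffD2 imageI lessThan_iff)
  then obtain y where y: "\<And>b i. b \<in> S \<Longrightarrow> i < 6 \<Longrightarrow> y b i > 0 \<and> int (a i) * int b + n = int (y b i) ^ k"
    by metis
  define q1 q2 q3 where "q1 b = p1 * b\<^sup>2 + e1 * b * of_int n + (of_int n)\<^sup>2"
    and "q2 b = p2 * b\<^sup>2 + e2 * b * of_int n + (of_int n)\<^sup>2"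
    and "q3 b = p3 * b\<^sup>2 + e3 * b * of_int n + (of_int n)\<^sup>2" for b
  define x :: "nat \<Rightarrow> nat \<Rightarrow> rat" where
    "x b = pt (of_nat (y b 0 * y b 1)) (of_nat (y b 2 * y b 3)) (of_nat (y b 4 * y b 5))" for b
  have x_power: "x b 0 ^ k = q1 (of_nat b)" "x b 1 ^ k = q2 (of_nat b)" "x b 2 ^ k = q3 (of_nat b)"
    if "b \<in> S" for b
  proof -
    have "(of_nat (y b i) :: rat) ^ k = r i * of_nat b + of_int n" if "i < 6" for i
      using arg_cong[OF conjunct2[OF y[OF \<open>b \<in> S\<close> that]], of "of_int :: int \<Rightarrow> rat"] by (simp add: r_def)
    then show "x b 0 ^ k = q1 (of_nat b)" "x b 1 ^ k = q2 (of_nat b)" "x b 2 ^ k = q3 (of_nat b)"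
      by (simp_all add: x_def power_mult_distrib q1_def q2_def q3_def p_def e_def power2_eq_square algebra_simps)
  qed
  have x_hom: "x b \<in> hom_coords 2" if "b \<in> S" for b
    unfolding x_def using y[OF that] by (intro pt_in_hom_coords) auto
  define Q where "Q b = proportional 2 `` {x b}" for b
  have "mpoly_eval (x b) f = 0" if "b \<in> S" for b
    using cofactor_relations(3)[of "of_nat b" "of_int n"] x_power[OF that]
    by (simp add: f_def mpoly_eval_conic_form q1_def q2_def q3_def power_mult mult.commute[of 2])
  then have Q_point: "Q b \<in> rational_points 2 {f}" if "b \<in> S" for b
    using that x_hom unfolding Q_def rational_points_def f_def
    by (intro class_in_proj_zeros[OF _ conic_form_in_forms]) auto
  have "b = b'" if b: "b \<in> S" "b' \<in> S" and eq: "Q b = Q b'" for b b'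
  proof -
    have "(x b, x b') \<in> proportional 2"
      using eq x_hom b eq_equiv_class[OF _ equiv_proportional] unfolding Q_def by blast
    then obtain s where s: "x b' = (\<lambda>i. s * x b i)" by (auto simp: proportional_def)
    then have "x b' i ^ k = s ^ k * x b i ^ k" for i by (simp add: power_mult_distrib)
    then have qs: "q1 (of_nat b') = s ^ k * q1 (of_nat b)" "q2 (of_nat b') = s ^ k * q2 (of_nat b)"
      "q3 (of_nat b') = s ^ k * q3 (of_nat b)"
      using x_power b by metis+
    have lin: "u * (s ^ k * z1) + v * (s ^ k * z2) + w * (s ^ k * z3) = s ^ k * (u * z1 + v * z2 + w * z3)"
      for u v w z1 z2 z3 by (simp add: algebra_simps)
    note rel = cofactor_relations(1,2)[of _ "of_int n", folded q1_def q2_def q3_def]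
    \<comment> \<open>The relation for \<open>\<Delta> t^2\<close> at \<open>t = n\<close> has the
      same value for \<open>b\<close> and \<open>b'\<close>, which forces \<open>s ^ k = 1\<close>;
      the relation for \<open>\<Delta> s t\<close> then recovers \<open>b\<close>.\<close>
    have "\<Delta> * (of_int n)\<^sup>2 = s ^ k * (\<Delta> * (of_int n)\<^sup>2)"
      using rel(2)[of "of_nat b'"] rel(2)[of "of_nat b"] by (simp only: qs lin)
    then have "s ^ k = 1" using \<Delta> n by simp
    moreover have "\<Delta> * of_nat b' * of_int n = s ^ k * (\<Delta> * of_nat b * of_int n)"
      using rel(1)[of "of_nat b'"] rel(1)[of "of_nat b"] by (simp only: qs lin)
    ultimately show "b = b'" using \<Delta> n by simp
  qed
  then have "card S \<le> card (rational_points 2 {f})"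
    using Q_point fin by (intro card_inj_on_le[of Q]) (auto intro: inj_onI)
  moreover have "card T \<le> card S + card (a ` {..<6})"
    unfolding S_def by (metis Un_Diff_cancel2 card_Un_le card_mono finite_UnI finite_Diff T(1)
        finite_imageI finite_lessThan order_trans sup_ge1)
  moreover have "card (a ` {..<6}) \<le> 6" using card_image_le[of "{..<6}" a] by simp
  ultimately show ?thesis using card by linarith
qed simp

theorem corollary2p13:
  assumes "uniformity_conjecture"
    and "lander_parkin_selfridge_special"
  shows "\<exists>C::nat. \<forall>k::nat. \<forall>n::int. k \<ge> 2 \<longrightarrow> n \<noteq> 0 \<longrightarrow> M k n \<le> enat C"
proof -
  have "\<exists>C. \<forall>F. smooth_projective_curve 2 F \<and> has_genus 2 F ((2 * k - 1) * (k - 1)) \<longrightarrow>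
      finite (rational_points 2 F) \<and> card (rational_points 2 F) \<le> C" if "k \<ge> 2" for k
  proof -
    \<comment> \<open>The genus is at least 2, as the uniformity conjecture demands.\<close>
    have "(2 * k - 1) * (k - 1) \<ge> 2 * 1" using that by (intro mult_mono) auto
    then show ?thesis using assms(1) unfolding uniformity_conjecture_def by (metis mult_1_right)
  qed
  then obtain B where B: "\<And>k F. k \<ge> 2 \<Longrightarrow> smooth_projective_curve 2 F \<Longrightarrow>
      has_genus 2 F ((2 * k - 1) * (k - 1)) \<Longrightarrow>
      finite (rational_points 2 F) \<and> card (rational_points 2 F) \<le> B k"
    by metis
  \<comment> \<open>The sum dominates \<open>B k\<close> for each of the finitely many
    \<open>k < 25\<close>; the summand 10 covers both the extra 6 there and the bound for large
    exponents.\<close>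
  define C where "C = (\<Sum>k<25. B k) + 10"
  have "M k n \<le> enat C" if "k \<ge> 2" "n \<noteq> 0" for k n
  proof (rule M_le_if_card_le)
    fix T assume T: "finite T" "T \<subseteq> {1..}" "property_D k n T"
    show "card T \<le> C"
    proof (cases "k < 25")
      case True
      then have "B k \<le> (\<Sum>k<25. B k)" by (intro member_le_sum) auto
      moreover have "card T \<le> B k + 6"
        using card_le_if_property_D[OF B[OF \<open>k \<ge> 2\<close>] _ \<open>n \<noteq> 0\<close> T(1,3)] \<open>k \<ge> 2\<close> by simp
      ultimately show ?thesis by (simp add: C_def)
    next
      case False
      then show ?thesis
        using card_le_10_if_property_D[OF assms(2) _ \<open>n \<noteq> 0\<close> T] by (simp add: C_def)
    qed
  qed
  then show ?thesis by blast
qed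

end
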